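(* Assume the setting described in the context, and suppose that ENNAMCQ holds, i.e. $0\notin\nabla R(w)+N_C(w)$ for every $w\in C$ with $R(w)\ge 0$. Suppose that the inverse-penalty grid satisfies $\widehat\gamma_t\le M_\gamma\widehat\gamma_{t+1}$ for some $M_\gamma>1$ and every $t\ge0$. Let $\{\mu_k\}$ be positive and nonincreasing with $\mu_k=\Theta((1+k)^{-r})$ for some $r\in(0,1)$, and let $\{\zeta_k\}$ satisfy $\zeta_k\le\bar\zeta\mu_k^q$ for some $\bar\zeta>0$ and $q>1/r$. Let $\{w^k\}$ be generated by the IVSP algorithm and, for each $k\ge0$, set $\widetilde\lambda_{k+1}:=\gamma_k^{-1}\phi_{\mu_k}'(\widetilde R^{k+1})$. Then, for every sufficiently large $K$, there exists $\widehat k\in[\lceil K/2\rceil,K]$ such that $$\Phi_\rho^{\rm s}(w^{\widehat k+1},\widetilde\lambda_{\widehat k+1})=O\bigl(K^{-(1-r)/2}\bigr),\qquad \Phi_\rho^{\rm f}(w^{\widehat k+1})=O(K^{-r}),\qquad \Phi_\rho^{\rm c}(w^{\widehat k+1},\widetilde\lambda_{\widehat k+1})=O(K^{-r}).$$ Consequently, an $(\varepsilon_s,\varepsilon_f,\varepsilon_c)$-KKT point of the problem $\min_{w\in C}f(w)$ s.t. $R(w)\le 0$ is obtained within $$K=O\Bigl(\max\bigl\{\varepsilon_s^{-2/(1-r)},\ \varepsilon_f^{-1/r},\ \varepsilon_c^{-1/r}\bigr\}\Bigr)$$ outer iterations.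
   Context: Problem setting. $X\subset\mathbb R^n$ and $Y\subset\mathbb R^m$ are nonempty, compact, convex; $C=X\times Y$ and $w=(x,y)$ denotes a point of $C$. The functions $f,g$ are real-valued, continuously differentiable on a neighborhood of $C$, and $\nabla f,\nabla g$ are $L_f$- resp. $L_g$-Lipschitz on $C$. $\sigma\ge0$ is such that $g(x,\cdot)+\frac\sigma2\|\cdot\|^2$ is convex on $Y$ for every $x\in X$. Fix $\rho>0$ with $\rho\sigma<1$ and $\delta>0$. Put $\psi_\rho(z;x,y)=g(x,z)+\frac1{2\rho}\|z-y\|^2$, $g_\rho(x,y)=\min_{z\in Y}\psi_\rho(z;x,y)$, with unique minimizer $z_\rho(x,y)$, and $R(w)=g(w)-g_\rho(w)-\delta$. $R$ is continuously differentiable on $C$ with $\nabla R(w)=\bigl(\nabla_xg(x,y)-\nabla_xg(x,z_\rho(w)),\ \nabla_yg(x,y)-\rho^{-1}(y-z_\rho(w))\bigr)$. $N_C$ is the normal cone, $P_C$ the Euclidean projection, $[t]_+=\max\{t,0\}$. KKT residuals. For $w\in C$, $\lambda\ge0$: $\Phi_\rho^{\rm s}(w,\lambda)=\operatorname{dist}(0,\nabla f(w)+\lambda\nabla R(w)+N_C(w))$, $\Phi_\rho^{\rm f}(w)=[R(w)]_+$, $\Phi_\rho^{\rm c}(w,\lambda)=|\lambda R(w)|$. A point $w\in C$ is an $(\varepsilon_s,\varepsilon_f,\varepsilon_c)$-KKT point if some $\lambda\ge0$ satisfies $\Phi_\rho^{\rm s}(w,\lambda)\le\varepsilon_s$, $\Phi_\rho^{\rm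 f}(w)\le\varepsilon_f$, $\Phi_\rho^{\rm c}(w,\lambda)\le\varepsilon_c$. Smoothing. For each $\mu>0$, $\phi_\mu:\mathbb R\to\mathbb R$ is convex, $C^1$, nondecreasing, and for constants $a_1,a_2,b_\phi,c_\phi\ge0$: $0\le\phi_\mu'\le1$; $[t]_+-a_1\mu\le\phi_\mu(t)\le[t]_++a_2\mu$; $|\phi_\mu'(t)-\phi_\mu'(s)|\le\frac{b_\phi}{\mu}|t-s|$; $\phi_{\mu_1}(t)\le\phi_{\mu_0}(t)+c_\phi(\mu_0-\mu_1)$ for $0<\mu_1\le\mu_0$. Set $a_\phi=a_1+a_2>0$. Constants. $m_\rho=\rho^{-1}-\sigma$; $L_{xy}>0$ is a Lipschitz constant of $y\mapsto\nabla_xg(x,y)$ on $Y$, uniform in $x\in X$; $L_R,B_R>0$ are a Lipschitz constant and a norm bound of $\nabla R$ on $C$; $L_{a,\rho}=\sqrt{L_{xy}^2+\rho^{-2}}$; $D_\rho(\zeta)=L_{a,\rho}\sqrt{2\zeta/m_\rho}$; $E_{\mu,\rho}(\zeta)=D_\rho(\zeta)+\frac{b_\phi B_R}{\mu}\zeta$; $L_G=b_\phi B_R^2+\mu_0L_R$. IVSP algorithm. Parameters: $c_1,c_2,\underline\vartheta>0$, $\hat\vartheta\in(0,2)$, $w^0\in C$, positive nonincreasing sequences $\mu_k\downarrow0$, $\zeta_k\downarrow0$, a strictly decreasing positive grid $\widehat\gamma_t\downarrow0$, $t_0=0$. A point $\widetilde z\in Y$ is $\zeta$-accurate at $w$ if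 $0\le\psi_\rho(\widetilde z;w)-g_\rho(w)\le\zeta$; it defines $\widetilde R(w)=g(w)-\psi_\rho(\widetilde z;w)-\delta$ and $\widetilde\nabla R(w)$, obtained from the formula for $\nabla R(w)$ by replacing $z_\rho(w)$ with $\widetilde z$. Start with a $\zeta_0$-accurate point $\widetilde z^0$ at $w^0$. At iteration $k$, with the current $\zeta_k$-accurate point $\widetilde z^k$ at $w^k$ and the associated $\widetilde R^k$, set $\gamma_k=\widehat\gamma_{t_k}$, $\widetilde\nabla G^k=\phi_{\mu_k}'(\widetilde R^k)\widetilde\nabla R(w^k)$ and, for $L>0$, $w_L^k=P_C\bigl(w^k-\frac{\mu_k}{L}[\gamma_k\nabla f(w^k)+\widetilde\nabla G^k]\bigr)$; compute a $\zeta_{k+1}$-accurate point $\widetilde z^+_{k,L}$ at $w_L^k$ with associated residual $\widetilde R^+_{k,L}$. Let $E_k^0=E_{\mu_k,\rho}(\zeta_k)$, $\vartheta_{k,L}=\max\{\min\{\mu_kE_k^0/\|w_L^k-w^k\|,\hat\vartheta L\},\underline\vartheta\}$ (the ratio is $+\infty$ if $w_L^k=w^k$), $\tau_{k,L}=\frac{\mu_k}{2\vartheta_{k,L}}(E_k^0)^2+\zeta_k+\zeta_{k+1}$. Choice of $L_k$: Strategy I uses a fixed $L_k=L\ge L_{\rm safe}:=\max\{\underline\vartheta/\hat\vartheta,\ (c_1+\widehat\gamma_0\mu_0L_f+L_G)/(2-\hat\vartheta)\}$. Strategy II starts from some $L_{k,0}\in[L_{\min},L_{\max}]$ ($0<L_{\min}\le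 L_{\max}<\infty$) and doubles $L$ until $$\gamma_kf(w_L^k)+\phi_{\mu_k}(\widetilde R^+_{k,L}+\zeta_{k+1})\le\gamma_kf(w^k)+\phi_{\mu_k}(\widetilde R^k)-\tfrac{c_1}{2\mu_k}\|w_L^k-w^k\|^2+\tau_{k,L};$$ $L_k$ is the accepted $L$. Set $w^{k+1}=w^k_{L_k}$, $\widetilde z^{k+1}=\widetilde z^+_{k,L_k}$, $\widetilde R^{k+1}=\widetilde R^+_{k,L_k}$. Penalty update: if $\widetilde R^{k+1}>2a_\phi\mu_k$ and $\|w^{k+1}-w^k\|\le c_2\mu_k\gamma_k$ then $t_{k+1}=t_k+1$, otherwise $t_{k+1}=t_k$. Convention. Constants hidden in $O$ may depend on the problem data and algorithm parameters (including $\delta,\rho,r,q$) but not on $K$ or on the tolerances; the last bound is understood for tolerances in $(0,1]$. *)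

theory Defs
  imports "HOL-Analysis.Analysis" "HOL-Library.Landau_Symbols"
begin

section \<open>Gradients, smoothness and normal cones\<close>

definition grad :: "('a::real_inner \<Rightarrow> real) \<Rightarrow> 'a \<Rightarrow> 'a" where
  "grad f x = (THE D. GDERIV f x :> D)"

definition C1_near :: "'a::real_inner set \<Rightarrow> ('a \<Rightarrow> real) \<Rightarrow> bool" where
  "C1_near C f \<longleftrightarrow>
     (\<exists>U. open U \<and> C \<subseteq> U \<and> (\<forall>w\<in>U. \<exists>D. GDERIV f w :> D) \<and> continuous_on U (grad f))"

definition normal_cone :: "'a::real_inner set \<Rightarrow> 'a \<Rightarrow> 'a set" where
  "normal_cone C w = {v. w \<in> C \<and> (\<forall>u\<in>C. inner v (u - w) \<le> 0)}"


section \<open>Regularized value function\<close>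

text \<open>Points of the product space are pairs \<open>w = (x, y)\<close>. The product type carries the Euclidean
  inner product, so the partial gradients of \<open>g\<close> are the two components of \<open>grad g\<close>.\<close>

definition psi :: "('a::euclidean_space \<times> 'b::euclidean_space \<Rightarrow> real) \<Rightarrow> real \<Rightarrow> 'b \<Rightarrow> 'a \<times> 'b \<Rightarrow> real" where
  "psi g \<rho> z w = g (fst w, z) + 1 / (2 * \<rho>) * (norm (z - snd w))\<^sup>2"

text \<open>For compact nonempty \<open>Y\<close> and continuous \<open>g\<close> the infimum below is a minimum.\<close>

definition g_reg :: "'b set \<Rightarrow> ('a::euclidean_space \<times> 'b::euclidean_space \<Rightarrow> real) \<Rightarrow> real \<Rightarrow> 'a \<times> 'b \<Rightarrow> real" where
  "g_reg Y g \<rho> w = (INF z\<in>Y. psi g \<rho> z w)"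

text \<open>Under the assumptions of interest the minimizer \<open>z_\<rho> w\<close> of \<open>psi g \<rho> \<cdot> w\<close> over \<open>Y\<close> is unique
  for \<open>w \<in> X \<times> Y\<close>, and by Danskin's theorem \<open>residual Y g \<rho> \<delta>\<close> has a full gradient at every
  such \<open>w\<close>, which is \<open>approx_grad_residual g \<rho> (z_\<rho> w) w\<close>.\<close>

definition residual ::
  "'b set \<Rightarrow> ('a::euclidean_space \<times> 'b::euclidean_space \<Rightarrow> real) \<Rightarrow> real \<Rightarrow> real \<Rightarrow> 'a \<times> 'b \<Rightarrow> real" where
  "residual Y g \<rho> \<delta> w = g w - g_reg Y g \<rho> w - \<delta>"

definition accurate ::
  "'b set \<Rightarrow> ('a::euclidean_space \<times> 'b::euclidean_space \<Rightarrow> real) \<Rightarrow> real \<Rightarrow> real \<Rightarrow> 'b \<Rightarrow> 'a \<times> 'b \<Rightarrow> bool" where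
  "accurate Y g \<rho> \<zeta> z w \<longleftrightarrow>
     z \<in> Y \<and> 0 \<le> psi g \<rho> z w - g_reg Y g \<rho> w \<and> psi g \<rho> z w - g_reg Y g \<rho> w \<le> \<zeta>"

definition approx_residual ::
  "('a::euclidean_space \<times> 'b::euclidean_space \<Rightarrow> real) \<Rightarrow> real \<Rightarrow> real \<Rightarrow> 'b \<Rightarrow> 'a \<times> 'b \<Rightarrow> real" where
  "approx_residual g \<rho> \<delta> z w = g w - psi g \<rho> z w - \<delta>"

definition approx_grad_residual ::
  "('a::euclidean_space \<times> 'b::euclidean_space \<Rightarrow> real) \<Rightarrow> real \<Rightarrow> 'b \<Rightarrow> 'a \<times> 'b \<Rightarrow> 'a \<times> 'b" where
  "approx_grad_residual g \<rho> z w =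
     (fst (grad g w) - fst (grad g (fst w, z)), snd (grad g w) - (1 / \<rho>) *\<^sub>R (snd w - z))"


section \<open>KKT residuals and constraint qualification\<close>

definition stat_residual ::
  "'a::real_inner set \<Rightarrow> ('a \<Rightarrow> real) \<Rightarrow> ('a \<Rightarrow> real) \<Rightarrow> 'a \<Rightarrow> real \<Rightarrow> real" where
  "stat_residual C f R w l = infdist 0 ((\<lambda>v. grad f w + l *\<^sub>R grad R w + v) ` normal_cone C w)"

definition feas_residual :: "('a \<Rightarrow> real) \<Rightarrow> 'a \<Rightarrow> real" where
  "feas_residual R w = max (R w) 0"

definition comp_residual :: "('a \<Rightarrow> real) \<Rightarrow> 'a \<Rightarrow> real \<Rightarrow> real" where
  "comp_residual R w l = \<bar>l * R w\<bar>"

definition KKT_point ::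
  "'a::real_inner set \<Rightarrow> ('a \<Rightarrow> real) \<Rightarrow> ('a \<Rightarrow> real) \<Rightarrow> real \<Rightarrow> real \<Rightarrow> real \<Rightarrow> 'a \<Rightarrow> bool" where
  "KKT_point C f R es ef ec w \<longleftrightarrow> w \<in> C \<and>
     (\<exists>l\<ge>0. stat_residual C f R w l \<le> es \<and> feas_residual R w \<le> ef \<and> comp_residual R w l \<le> ec)"

definition ENNAMCQ :: "'a::real_inner set \<Rightarrow> ('a \<Rightarrow> real) \<Rightarrow> bool" where
  "ENNAMCQ C R \<longleftrightarrow> (\<forall>w\<in>C. R w \<ge> 0 \<longrightarrow> 0 \<notin> (\<lambda>v. grad R w + v) ` normal_cone C w)"


section \<open>Smoothing of the positive part\<close>

definition smoothing ::
  "(real \<Rightarrow> real \<Rightarrow> real) \<Rightarrow> real \<Rightarrow> real \<Rightarrow> real \<Rightarrow> real \<Rightarrow> bool" where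
  "smoothing \<phi> a1 a2 b c \<longleftrightarrow>
     0 \<le> a1 \<and> 0 \<le> a2 \<and> 0 \<le> b \<and> 0 \<le> c \<and>
     (\<forall>\<mu>>0. convex_on UNIV (\<phi> \<mu>) \<and> \<phi> \<mu> C1_differentiable_on UNIV \<and> mono (\<phi> \<mu>) \<and>
        (\<forall>t. 0 \<le> deriv (\<phi> \<mu>) t \<and> deriv (\<phi> \<mu>) t \<le> 1) \<and>
        (\<forall>t. max t 0 - a1 * \<mu> \<le> \<phi> \<mu> t \<and> \<phi> \<mu> t \<le> max t 0 + a2 * \<mu>) \<and>
        (\<forall>s t. \<bar>deriv (\<phi> \<mu>) t - deriv (\<phi> \<mu>) s\<bar> \<le> b / \<mu> * \<bar>t - s\<bar>)) \<and>
     (\<forall>\<mu>0 \<mu>1 t. 0 < \<mu>1 \<and> \<mu>1 \<le> \<mu>0 \<longrightarrow> \<phi> \<mu>1 t \<le> \<phi> \<mu>0 t + c * (\<mu>0 - \<mu>1))"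


section \<open>The IVSP algorithm\<close>

text \<open>\<open>Fixed L\<close> is the constant choice \<open>L_k = L\<close>; \<open>Doubling L_min L_max\<close> is backtracking by doubling
  from an initial value in \<open>[L_min, L_max]\<close>.\<close>

datatype step_rule = Fixed real | Doubling real real

locale ivsp_algorithm =
  fixes X :: "'a::euclidean_space set" and Y :: "'b::euclidean_space set"
    and f g :: "'a \<times> 'b \<Rightarrow> real"
    and \<sigma> \<rho> \<delta> L_f L_xy L_R B_R :: real
    and \<phi> :: "real \<Rightarrow> real \<Rightarrow> real" and a1 a2 b_phi :: real
    and c1 c2 theta_low theta_hat :: real
    and w0 :: "'a \<times> 'b"
    and \<mu> \<zeta> grid :: "nat \<Rightarrow> real"
    and rule :: step_rule
begin

definition L_G :: real where
  "L_G = b_phi * B_R\<^sup>2 + \<mu> 0 * L_R"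

definition L_safe :: real where
  "L_safe = max (theta_low / theta_hat) ((c1 + grid 0 * \<mu> 0 * L_f + L_G) / (2 - theta_hat))"

definition D_err :: "real \<Rightarrow> real" where
  "D_err s = sqrt (L_xy\<^sup>2 + (1 / \<rho>)\<^sup>2) * sqrt (2 * s / (1 / \<rho> - \<sigma>))"

definition E_err :: "real \<Rightarrow> real \<Rightarrow> real" where
  "E_err m s = D_err s + b_phi * B_R / m * s"

text \<open>In the following, \<open>k\<close> is the iteration counter, \<open>t\<close> the current grid index, \<open>w\<close> and \<open>z\<close> the
  current iterate and its inexact lower-level point, \<open>L\<close> a trial value and \<open>zp\<close> the inexact
  lower-level point computed at the trial point.\<close>

definition approx_grad_G :: "nat \<Rightarrow> 'b \<Rightarrow> 'a \<times> 'b \<Rightarrow> 'a \<times> 'b" where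
  "approx_grad_G k z w =
     deriv (\<phi> (\<mu> k)) (approx_residual g \<rho> \<delta> z w) *\<^sub>R approx_grad_residual g \<rho> z w"

definition trial :: "nat \<Rightarrow> nat \<Rightarrow> 'a \<times> 'b \<Rightarrow> 'b \<Rightarrow> real \<Rightarrow> 'a \<times> 'b" where
  "trial k t w z L =
     closest_point (X \<times> Y) (w - (\<mu> k / L) *\<^sub>R (grid t *\<^sub>R grad f w + approx_grad_G k z w))"

text \<open>The quotient \<open>\<mu> k * E / d\<close> with \<open>d = 0\<close> is read as \<open>+\<infinity>\<close>.\<close>

definition theta :: "nat \<Rightarrow> real \<Rightarrow> real \<Rightarrow> real" where
  "theta k L d =
     max (if d = 0 then theta_hat * L else min (\<mu> k * E_err (\<mu> k) (\<zeta> k) / d) (theta_hat * L)) theta_low"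

definition tau :: "nat \<Rightarrow> real \<Rightarrow> real \<Rightarrow> real" where
  "tau k L d = \<mu> k / (2 * theta k L d) * (E_err (\<mu> k) (\<zeta> k))\<^sup>2 + \<zeta> k + \<zeta> (Suc k)"

definition accept :: "nat \<Rightarrow> nat \<Rightarrow> 'a \<times> 'b \<Rightarrow> 'b \<Rightarrow> real \<Rightarrow> 'b \<Rightarrow> bool" where
  "accept k t w z L zp \<longleftrightarrow>
     (let wL = trial k t w z L; d = norm (wL - w)
      in grid t * f wL + \<phi> (\<mu> k) (approx_residual g \<rho> \<delta> zp wL + \<zeta> (Suc k))
         \<le> grid t * f w + \<phi> (\<mu> k) (approx_residual g \<rho> \<delta> z w) - c1 / (2 * \<mu> k) * d\<^sup>2 + tau k L d)"

text \<open>\<open>step_choice k t w z zp L\<close>: the rule selects \<open>L\<close>, where \<open>zp\<close> maps each tested trial value to a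
  \<open>\<zeta> (Suc k)\<close>-accurate point at the corresponding trial point.\<close>

definition step_choice :: "nat \<Rightarrow> nat \<Rightarrow> 'a \<times> 'b \<Rightarrow> 'b \<Rightarrow> (real \<Rightarrow> 'b) \<Rightarrow> real \<Rightarrow> bool" where
  "step_choice k t w z zp L \<longleftrightarrow>
     (case rule of
        Fixed L' \<Rightarrow> L = L' \<and> accurate Y g \<rho> (\<zeta> (Suc k)) (zp L) (trial k t w z L)
      | Doubling Lmin Lmax \<Rightarrow>
          (\<exists>L0 j. Lmin \<le> L0 \<and> L0 \<le> Lmax \<and> L = 2 ^ j * L0 \<and>
             (\<forall>i\<le>j. accurate Y g \<rho> (\<zeta> (Suc k)) (zp (2 ^ i * L0)) (trial k t w z (2 ^ i * L0))) \<and>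
             (\<forall>i<j. \<not> accept k t w z (2 ^ i * L0) (zp (2 ^ i * L0))) \<and>
             accept k t w z L (zp L)))"

definition valid_rule :: bool where
  "valid_rule \<longleftrightarrow>
     (case rule of Fixed L \<Rightarrow> L_safe \<le> L | Doubling Lmin Lmax \<Rightarrow> 0 < Lmin \<and> Lmin \<le> Lmax)"

text \<open>\<open>run w z t\<close>: the iterates \<open>w\<close>, the inexact lower-level points \<open>z\<close> and the grid indices \<open>t\<close>
  form a complete execution of the algorithm.\<close>

definition run :: "(nat \<Rightarrow> 'a \<times> 'b) \<Rightarrow> (nat \<Rightarrow> 'b) \<Rightarrow> (nat \<Rightarrow> nat) \<Rightarrow> bool" where
  "run w z t \<longleftrightarrow>
     valid_rule \<and> w 0 = w0 \<and> accurate Y g \<rho> (\<zeta> 0) (z 0) (w 0) \<and> t 0 = 0 \<and>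
     (\<forall>k. \<exists>zp L. step_choice k (t k) (w k) (z k) zp L \<and>
        w (Suc k) = trial k (t k) (w k) (z k) L \<and>
        z (Suc k) = zp L \<and>
        t (Suc k) =
          (if approx_residual g \<rho> \<delta> (z (Suc k)) (w (Suc k)) > 2 * (a1 + a2) * \<mu> k \<and>
              norm (w (Suc k) - w k) \<le> c2 * \<mu> k * grid (t k)
           then t k + 1 else t k))"

definition multiplier :: "(nat \<Rightarrow> 'a \<times> 'b) \<Rightarrow> (nat \<Rightarrow> 'b) \<Rightarrow> (nat \<Rightarrow> nat) \<Rightarrow> nat \<Rightarrow> real" where
  "multiplier w z t k =
     inverse (grid (t k)) * deriv (\<phi> (\<mu> k)) (approx_residual g \<rho> \<delta> (z (Suc k)) (w (Suc k)))"

end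

end

theory Submission
  imports Defs
begin

text \<open>The step test yields a descent of the energy \<open>grid t * f + \<phi> R\<close> up to summable errors, so that
  \<open>\<Sum>k. d_k\<^sup>2 / \<mu> k\<close> is bounded for the step lengths \<open>d_k = norm (w (k + 1) - w k)\<close>. The optimality
  condition of the projection bounds the stationarity residual of the penalized problem by a multiple
  of \<open>d_k / \<mu> k\<close> plus an error that vanishes. By compactness the constraint qualification holds with a
  uniform constant, which excludes penalty updates once the inverse penalty and the error are small:
  the number of updates, and hence the penalty, is bounded independently of the run. Among the
  indices in \<open>[K / 2, K]\<close> there is then one without an update and with
  \<open>d_k\<^sup>2 / \<mu> k = O(1 / K)\<close>, that is \<open>d_k / \<mu> k = O(K powr (- (1 - r) / 2))\<close>; there the update test fails,
  so the residual is \<open>O(\<mu> k)\<close>, and convexity of the smoothing bounds the complementarity residual by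
  \<open>O(\<mu> k)\<close> as well.\<close>

section \<open>Gradients\<close>

lemma gderiv_unique:
  assumes "GDERIV f x :> D" "GDERIV f x :> E"
  shows "D = E"
proof -
  have "(\<lambda>h. inner h D) = (\<lambda>h. inner h E)"
    using assms unfolding gderiv_def by (rule has_derivative_unique)
  then have "inner (D - E) (D - E) = 0"
    by (simp add: inner_diff_right fun_eq_iff)
  then show ?thesis by simp
qed

lemma grad_eq: "GDERIV f x :> D \<Longrightarrow> grad f x = D"
  unfolding grad_def by (rule the_equality) (auto intro: gderiv_unique)

lemma gderiv_grad: "GDERIV f x :> D \<Longrightarrow> GDERIV f x :> grad f x"
  by (simp add: grad_eq)

lemma gderiv_continuous_on:
  assumes "\<And>x. x \<in> S \<Longrightarrow> GDERIV f x :> D x"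
  shows "continuous_on S f"
  by (rule continuous_at_imp_continuous_on)
    (use assms has_derivative_continuous in \<open>force simp: gderiv_def\<close>)

lemma gderiv_norm_diff_le:
  fixes f :: "'a::real_inner \<Rightarrow> real"
  assumes "convex S" "\<And>x. x \<in> S \<Longrightarrow> GDERIV f x :> D x" "\<And>x. x \<in> S \<Longrightarrow> norm (D x) \<le> B"
    and "x \<in> S" "y \<in> S"
  shows "\<bar>f x - f y\<bar> \<le> B * norm (x - y)"
proof -
  have "onorm (\<lambda>h. inner h (D z)) \<le> B" if "z \<in> S" for z
  proof (rule onorm_bound)
    show "0 \<le> B" using assms(3)[OF that] norm_ge_zero order_trans by blast
    fix h
    have "norm (inner h (D z)) \<le> norm h * norm (D z)" by (simp add: Cauchy_Schwarz_ineq2)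
    also have "\<dots> \<le> norm h * B" using assms(3)[OF that] by (simp add: mult_left_mono)
    finally show "norm (inner h (D z)) \<le> B * norm h" by (simp add: mult.commute)
  qed
  then have "norm (f x - f y) \<le> B * norm (x - y)"
    using assms(2) unfolding gderiv_def
    by (intro differentiable_bound[OF assms(1) _ _ assms(4,5)]) (auto intro: has_derivative_at_withinI)
  then show ?thesis by simp
qed

lemma gderiv_linearization_le:
  fixes f :: "'a::real_inner \<Rightarrow> real"
  assumes "convex S" "\<And>x. x \<in> S \<Longrightarrow> GDERIV f x :> D x"
    and "\<And>x. x \<in> S \<Longrightarrow> norm (D x - D0) \<le> e" and "x \<in> S" "y \<in> S"
  shows "\<bar>f x - f y - inner (x - y) D0\<bar> \<le> e * norm (x - y)"
proof -
  have "GDERIV (\<lambda>x. f x - inner x D0) z :> D z - D0" if "z \<in> S" for z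
    using assms(2)[OF that] unfolding gderiv_def inner_diff_right
    by (auto intro!: derivative_eq_intros)
  from gderiv_norm_diff_le[OF assms(1) this assms(3-5)] show ?thesis
    by (simp add: inner_diff_left algebra_simps)
qed

lemma descent_lemma:
  fixes f :: "'a::real_inner \<Rightarrow> real"
  assumes "convex S" "\<And>x. x \<in> S \<Longrightarrow> GDERIV f x :> D x" "L-lipschitz_on S D"
    and "x \<in> S" "y \<in> S"
  shows "f y \<le> f x + inner (y - x) (D x) + L / 2 * (norm (y - x))\<^sup>2"
proof -
  define p where "p s = x + s *\<^sub>R (y - x)" for s
  define h where "h s = f (p s) - s * inner (y - x) (D x) - L / 2 * s\<^sup>2 * (norm (y - x))\<^sup>2" for s
  have pS: "p s \<in> S" if "0 \<le> s" "s \<le> 1" for s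
  proof -
    have "p s = (1 - s) *\<^sub>R x + s *\<^sub>R y" by (simp add: p_def algebra_simps)
    then show ?thesis using assms(1,4,5) that by (auto intro: convexD_alt)
  qed
  have *: "\<exists>d. (h has_real_derivative d) (at s) \<and> d \<le> 0" if s: "0 \<le> s" "s \<le> 1" for s
  proof (intro exI conjI)
    have f: "(f has_derivative (\<lambda>h. inner h (D (p s)))) (at (p s))"
      using assms(2)[OF pS[OF s]] by (simp add: gderiv_def)
    have p: "(p has_derivative (\<lambda>a. a *\<^sub>R (y - x))) (at s)"
      unfolding p_def by (auto intro!: derivative_eq_intros)
    have "((\<lambda>s. f (p s)) has_derivative (\<lambda>a. inner (a *\<^sub>R (y - x)) (D (p s)))) (at s)"
      by (rule has_derivative_compose[OF p f])
    then have "((\<lambda>s. f (p s)) has_real_derivative inner (y - x) (D (p s))) (at s)"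
      by (simp add: has_field_derivative_def mult_commute_abs)
    then show "(h has_real_derivative
        inner (y - x) (D (p s)) - inner (y - x) (D x) - L * s * (norm (y - x))\<^sup>2) (at s)"
      unfolding h_def by (auto intro!: derivative_eq_intros)
    have "inner (y - x) (D (p s)) - inner (y - x) (D x) = inner (y - x) (D (p s) - D x)"
      by (simp add: inner_diff_right)
    also have "\<dots> \<le> norm (y - x) * norm (D (p s) - D x)" by (rule norm_cauchy_schwarz)
    also have "\<dots> \<le> norm (y - x) * (L * norm (p s - x))"
      using lipschitz_on_normD[OF assms(3) pS[OF s] assms(4)] by (simp add: mult_left_mono)
    also have "\<dots> = L * s * (norm (y - x))\<^sup>2" using s by (simp add: p_def power2_eq_square)
    finally show "inner (y - x) (D (p s)) - inner (y - x) (D x) - L * s * (norm (y - x))\<^sup>2 \<le> 0"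
      by simp
  qed
  have "h 1 \<le> h 0" by (rule DERIV_nonpos_imp_nonincreasing[of 0 1, OF _ *]) auto
  then show ?thesis unfolding h_def p_def by simp
qed

text \<open>Danskin's theorem at a point with a unique minimizer: the upper bound tests with that
  minimizer, the lower bound with a minimizer at the perturbed point, which is close to it.\<close>

lemma danskin:
  fixes F :: "'b::euclidean_space \<Rightarrow> 'a::euclidean_space \<Rightarrow> real"
  assumes Y: "compact Y" and z0: "z0 \<in> Y" and r: "r > 0"
    and deriv: "\<And>z v. z \<in> Y \<Longrightarrow> v \<in> cball w r \<Longrightarrow> GDERIV (F z) v :> p z v"
    and contp: "continuous_on (Y \<times> cball w r) (\<lambda>(z, v). p z v)"
    and contF: "\<And>v. v \<in> cball w r \<Longrightarrow> continuous_on Y (\<lambda>z. F z v)"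
    and uniq: "\<And>z. z \<in> Y \<Longrightarrow> z \<noteq> z0 \<Longrightarrow> F z0 w < F z w"
  shows "GDERIV (\<lambda>v. INF z\<in>Y. F z v) w :> p z0 w"
proof -
  define h where "h v = (INF z\<in>Y. F z v)" for v
  have minim: "\<exists>z\<in>Y. h v = F z v \<and> (\<forall>z'\<in>Y. F z v \<le> F z' v)" if "v \<in> cball w r" for v
  proof -
    obtain z where z: "z \<in> Y" "\<forall>z'\<in>Y. F z v \<le> F z' v"
      using continuous_attains_inf[OF Y _ contF[OF \<open>v \<in> cball w r\<close>]] z0 by blast
    then have "h v = F z v" unfolding h_def by (intro cInf_eq_minimum) auto
    then show ?thesis using z by blast
  qed
  have ww: "w \<in> cball w r" using r by simp
  have hw: "h w = F z0 w"
  proof -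
    have "F z0 w \<le> F z w" if "z \<in> Y" for z using uniq[OF that] by fastforce
    then show ?thesis unfolding h_def using z0 by (intro cInf_eq_minimum) auto
  qed
  have cpt: "compact (Y \<times> cball w r)" using Y by (simp add: compact_Times)
  obtain B where "B > 0" and B: "\<And>z v. z \<in> Y \<Longrightarrow> v \<in> cball w r \<Longrightarrow> norm (p z v) \<le> B"
    using compact_imp_bounded[OF compact_continuous_image[OF contp cpt]]
    unfolding bounded_pos by (auto simp: image_iff)
  have "\<exists>d>0. \<forall>v. norm (v - w) < d \<longrightarrow>
      norm (h v - h w - inner (v - w) (p z0 w)) \<le> e * norm (v - w)" if e: "e > 0" for e
  proof -
    obtain d1 where d1: "d1 > 0" "\<And>z v z' v'. z \<in> Y \<Longrightarrow> v \<in> cball w r \<Longrightarrow> z' \<in> Y \<Longrightarrow>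
        v' \<in> cball w r \<Longrightarrow> dist (z', v') (z, v) < d1 \<Longrightarrow> dist (p z' v') (p z v) < e / 2"
    proof -
      obtain d where d: "d > 0" "\<forall>a\<in>Y \<times> cball w r. \<forall>b\<in>Y \<times> cball w r.
          dist b a < d \<longrightarrow> dist (case b of (z, v) \<Rightarrow> p z v) (case a of (z, v) \<Rightarrow> p z v) < e / 2"
        using compact_uniformly_continuous[OF contp cpt] half_gt_zero[OF e]
        unfolding uniformly_continuous_on_def by blast
      show ?thesis
      proof (rule that[OF d(1)])
        fix z v z' v' assume "z \<in> Y" "v \<in> cball w r" "z' \<in> Y" "v' \<in> cball w r"
          "dist (z', v') (z, v) < d"
        then show "dist (p z' v') (p z v) < e / 2"
          using d(2)[rule_format, of "(z, v)" "(z', v')"] by (simp del: dist_Pair_Pair)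
      qed
    qed
    obtain c where c: "c > 0" "\<And>z. z \<in> Y \<Longrightarrow> d1 \<le> dist z z0 \<Longrightarrow> F z0 w + c \<le> F z w"
    proof (cases "Y - ball z0 d1 = {}")
      case True
      then show ?thesis using that[of 1] by (fastforce simp: dist_commute)
    next
      case False
      have "compact (Y - ball z0 d1)" using Y by (simp add: compact_diff)
      moreover have "continuous_on (Y - ball z0 d1) (\<lambda>z. F z w)"
        by (rule continuous_on_subset[OF contF[OF ww]]) auto
      ultimately obtain z1 where z1: "z1 \<in> Y - ball z0 d1"
          "\<forall>z\<in>Y - ball z0 d1. F z1 w \<le> F z w"
        using continuous_attains_inf False by blast
      show ?thesis
      proof (rule that[of "F z1 w - F z0 w"])
        show "0 < F z1 w - F z0 w" using uniq[of z1] z1 d1(1) by (cases "z1 = z0") auto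
      qed (use z1 in \<open>auto simp: dist_commute\<close>)
    qed
    define d where "d = min (min r d1) (c / (2 * B))"
    show ?thesis
    proof (intro exI conjI allI impI)
      show "d > 0" using r d1 c \<open>B > 0\<close> by (simp add: d_def)
      fix v assume v: "norm (v - w) < d"
      define S where "S = cball w (norm (v - w))"
      have vS: "v \<in> S" "w \<in> S" by (simp_all add: S_def dist_norm norm_minus_commute)
      have Sr: "S \<subseteq> cball w r" using v by (auto simp: S_def d_def)
      have lin: "\<bar>F z v - F z w - inner (v - w) (p z w)\<bar> \<le> e / 2 * norm (v - w)" if "z \<in> Y" for z
      proof (rule gderiv_linearization_le[of S _ "p z"])
        fix u assume u: "u \<in> S"
        have "dist (z, u) (z, w) < d1" using u v by (simp add: dist_Pair_Pair S_def d_def dist_commute)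
        then show "norm (p z u - p z w) \<le> e / 2"
          using d1(2)[OF that ww that, of u] u Sr by (auto simp: dist_norm)
      qed (use deriv[OF that] Sr vS in \<open>auto simp: S_def\<close>)
      have lip: "\<bar>F z v - F z w\<bar> \<le> B * norm (v - w)" if "z \<in> Y" for z
        by (rule gderiv_norm_diff_le[of S _ "p z"])
          (use deriv[OF that] B[OF that] Sr vS in \<open>auto simp: S_def\<close>)
      obtain z where z: "z \<in> Y" "h v = F z v" "\<forall>z'\<in>Y. F z v \<le> F z' v"
        using minim[of v] vS Sr by blast
      have "2 * (B * norm (v - w)) < c"
        using v \<open>B > 0\<close> by (simp add: d_def field_simps)
      moreover have "F z v \<le> F z0 v" using z z0 by blast
      ultimately have "F z w < F z0 w + c"
        using lip[OF z(1)] lip[OF z0] by linarith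
      then have "dist z z0 < d1" using c(2)[OF z(1)] by linarith
      then have "dist (z, w) (z0, w) < d1" by (simp add: dist_Pair_Pair)
      then have "norm (p z w - p z0 w) < e / 2"
        using d1(2)[OF z0 ww z(1) ww] by (simp add: dist_norm)
      then have "\<bar>inner (v - w) (p z w - p z0 w)\<bar> \<le> norm (v - w) * (e / 2)"
        by (meson Cauchy_Schwarz_ineq2 order_trans mult_left_mono norm_ge_zero less_imp_le)
      then have "\<bar>inner (v - w) (p z w) - inner (v - w) (p z0 w)\<bar> \<le> e / 2 * norm (v - w)"
        by (simp add: inner_diff_right mult.commute)
      moreover have "F z0 w \<le> F z w" using uniq[OF z(1)] by fastforce
      ultimately have "\<bar>h v - h w - inner (v - w) (p z0 w)\<bar> \<le> e * norm (v - w)"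
        using lin[OF z(1)] lin[OF z0] \<open>F z v \<le> F z0 v\<close> unfolding z(2) hw by argo
      then show "norm (h v - h w - inner (v - w) (p z0 w)) \<le> e * norm (v - w)" by simp
    qed
  qed
  then show ?thesis
    unfolding gderiv_def has_derivative_at_alt h_def[symmetric]
    by (intro conjI bounded_linear_inner_left allI impI) simp
qed

lemma quadratic_growth:
  fixes F :: "'b::real_inner \<Rightarrow> real"
  assumes conv: "convex_on Y (\<lambda>z. F z - m / 2 * (norm z)\<^sup>2)"
    and z0: "z0 \<in> Y" "\<And>z. z \<in> Y \<Longrightarrow> F z0 \<le> F z" and z: "z \<in> Y"
  shows "F z0 + m / 2 * (norm (z - z0))\<^sup>2 \<le> F z"
proof -
  have bound: "F z0 + m / 2 * (1 - s) * (norm (z - z0))\<^sup>2 \<le> F z" if s: "0 < s" "s \<le> 1" for s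
  proof -
    let ?u = "(1 - s) *\<^sub>R z0 + s *\<^sub>R z"
    have "?u \<in> Y" using conv z0(1) z s by (auto simp: convex_on_def intro: convexD_alt)
    then have "F z0 \<le> F ?u" by (rule z0(2))
    moreover have "F ?u - m / 2 * (norm ?u)\<^sup>2 \<le>
        (1 - s) * (F z0 - m / 2 * (norm z0)\<^sup>2) + s * (F z - m / 2 * (norm z)\<^sup>2)"
      using convex_onD[OF conv, of s z0 z] s z0(1) z by simp
    moreover have nu: "(norm ?u)\<^sup>2 = (1 - s) * (norm z0)\<^sup>2 + s * (norm z)\<^sup>2 - s * (1 - s) * (norm (z - z0))\<^sup>2"
      unfolding power2_norm_eq_inner by (simp add: inner_simps algebra_simps inner_commute)
    ultimately have "F z0 - m / 2 * ((1 - s) * (norm z0)\<^sup>2 + s * (norm z)\<^sup>2 - s * (1 - s) * (norm (z - z0))\<^sup>2)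
        \<le> (1 - s) * (F z0 - m / 2 * (norm z0)\<^sup>2) + s * (F z - m / 2 * (norm z)\<^sup>2)"
      unfolding nu by linarith
    then have "s * (F z0 + m / 2 * (1 - s) * (norm (z - z0))\<^sup>2) \<le> s * F z"
      by (simp add: field_simps)
    then show ?thesis using s(1) by (simp only: mult_le_cancel_left_pos)
  qed
  have lim: "((\<lambda>s. F z0 + m / 2 * (1 - s) * (norm (z - z0))\<^sup>2) \<longlongrightarrow>
      F z0 + m / 2 * (1 - 0) * (norm (z - z0))\<^sup>2) (at_right 0)"
    by (intro tendsto_intros)
  have "eventually (\<lambda>s. F z0 + m / 2 * (1 - s) * (norm (z - z0))\<^sup>2 \<le> F z) (at_right 0)"
    unfolding eventually_at_right_field using bound by (intro exI[of _ 1]) auto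
  from tendsto_upperbound[OF lim this] show ?thesis by simp
qed

section \<open>Smoothed positive part\<close>

lemma smoothing_DERIV:
  assumes "smoothing \<phi> a1 a2 b c" "\<mu> > 0"
  shows "DERIV (\<phi> \<mu>) t :> deriv (\<phi> \<mu>) t"
proof -
  have "\<phi> \<mu> C1_differentiable_on UNIV" using assms by (simp add: smoothing_def)
  then obtain D where "(\<phi> \<mu> has_vector_derivative D) (at t)"
    unfolding C1_differentiable_on_def by blast
  then have "DERIV (\<phi> \<mu>) t :> D" by (simp add: has_real_derivative_iff_has_vector_derivative)
  then show ?thesis using DERIV_imp_deriv by fastforce
qed

lemma smoothing_deriv_bounds:
  assumes "smoothing \<phi> a1 a2 b c" "\<mu> > 0"
  shows "0 \<le> deriv (\<phi> \<mu>) t" "deriv (\<phi> \<mu>) t \<le> 1"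
    "\<bar>deriv (\<phi> \<mu>) t - deriv (\<phi> \<mu>) s\<bar> \<le> b / \<mu> * \<bar>t - s\<bar>"
  using assms by (simp_all add: smoothing_def)

lemma smoothing_bounds:
  assumes "smoothing \<phi> a1 a2 b c" "\<mu> > 0"
  shows "max t 0 - a1 * \<mu> \<le> \<phi> \<mu> t" "\<phi> \<mu> t \<le> max t 0 + a2 * \<mu>"
  using assms by (simp_all add: smoothing_def)

lemma smoothing_mono:
  assumes "smoothing \<phi> a1 a2 b c" "\<mu> > 0" "s \<le> t"
  shows "\<phi> \<mu> s \<le> \<phi> \<mu> t"
  using assms by (simp add: smoothing_def monoD)

lemma smoothing_nonexpansive:
  assumes "smoothing \<phi> a1 a2 b c" "\<mu> > 0" "s \<le> t"
  shows "\<phi> \<mu> t \<le> \<phi> \<mu> s + (t - s)"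
proof -
  have "\<bar>\<phi> \<mu> t - \<phi> \<mu> s\<bar> \<le> 1 * norm (t - s)"
    by (rule gderiv_norm_diff_le[of UNIV _ "deriv (\<phi> \<mu>)"])
      (use smoothing_DERIV[OF assms(1,2)] smoothing_deriv_bounds[OF assms(1,2)] in auto)
  then show ?thesis using assms(3) by simp
qed

lemma smoothing_tangent_0:
  assumes "smoothing \<phi> a1 a2 b c" "\<mu> > 0"
  shows "\<phi> \<mu> t - t * deriv (\<phi> \<mu>) t \<le> \<phi> \<mu> 0"
proof -
  have "convex_on UNIV (\<phi> \<mu>)" using assms by (simp add: smoothing_def)
  from convex_on_imp_above_tangent[OF this connected_UNIV, of t 0 "deriv (\<phi> \<mu>) t"]
  show ?thesis using smoothing_DERIV[OF assms, of t] by (simp add: algebra_simps)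
qed

lemma smoothing_deriv_ge_half:
  assumes "smoothing \<phi> a1 a2 b c" "\<mu> > 0" "t > 2 * (a1 + a2) * \<mu>"
  shows "deriv (\<phi> \<mu>) t \<ge> 1 / 2"
proof -
  have "0 \<le> a1" "0 \<le> a2" using assms by (simp_all add: smoothing_def)
  then have t: "t > 0" using assms(2,3) by (smt (verit) mult_nonneg_nonneg)
  have "t - (a1 + a2) * \<mu> \<le> t * deriv (\<phi> \<mu>) t"
    using smoothing_tangent_0[OF assms(1,2), of t] smoothing_bounds[OF assms(1,2), of t]
      smoothing_bounds[OF assms(1,2), of 0] t by (simp add: algebra_simps)
  then have "t * (1 / 2) \<le> t * deriv (\<phi> \<mu>) t" using assms(3) by argo
  then show ?thesis using t by (simp only: mult_le_cancel_left_pos)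
qed

lemma smoothing_deriv_mult_le:
  assumes "smoothing \<phi> a1 a2 b c" "\<mu> > 0" "t \<le> 0"
  shows "deriv (\<phi> \<mu>) t * \<bar>t\<bar> \<le> (a1 + a2) * \<mu>"
  using smoothing_tangent_0[OF assms(1,2), of t] smoothing_bounds[OF assms(1,2), of t]
    smoothing_bounds[OF assms(1,2), of 0] assms(3) by (simp add: algebra_simps)

section \<open>Normal cones and the constraint qualification\<close>

lemma normal_cone_scale:
  "v \<in> normal_cone C w \<Longrightarrow> 0 \<le> c \<Longrightarrow> c *\<^sub>R v \<in> normal_cone C w"
  by (auto simp: normal_cone_def mult_nonneg_nonpos)

lemma stat_residual_le:
  assumes "v \<in> normal_cone C w"
  shows "stat_residual C f R w l \<le> norm (grad f w + l *\<^sub>R grad R w + v)"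
proof -
  have "stat_residual C f R w l \<le> dist 0 (grad f w + l *\<^sub>R grad R w + v)"
    unfolding stat_residual_def using assms by (intro infdist_le) auto
  then show ?thesis by simp
qed

text \<open>Compactness upgrades the pointwise constraint qualification to a uniform lower bound, because
  the graph of the normal cone is closed.\<close>

lemma ENNAMCQ_uniform:
  fixes C :: "'a::euclidean_space set"
  assumes C: "compact C" and R: "continuous_on C R" "continuous_on C (grad R)"
    and cq: "ENNAMCQ C R"
  obtains \<kappa> where "\<kappa> > 0"
    "\<And>w v. w \<in> C \<Longrightarrow> R w \<ge> 0 \<Longrightarrow> v \<in> normal_cone C w \<Longrightarrow> \<kappa> \<le> norm (grad R w + v)"
proof (rule ccontr)
  assume neg: "\<not> thesis"
  have "\<exists>w v. w \<in> C \<and> R w \<ge> 0 \<and> v \<in> normal_cone C w \<and> norm (grad R w + v) < inverse (real (Suc n))" for n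
    using neg that[of "inverse (real (Suc n))"]
    by (metis inverse_positive_iff_positive not_less of_nat_0_less_iff zero_less_Suc)
  then obtain w v where wv: "\<And>n. w n \<in> C" "\<And>n. R (w n) \<ge> 0" "\<And>n. v n \<in> normal_cone C (w n)"
      "\<And>n. norm (grad R (w n) + v n) < inverse (real (Suc n))" by metis
  obtain l s where ls: "l \<in> C" "strict_mono s" "(w \<circ> s) \<longlonglongrightarrow> l"
    using C wv(1) unfolding compact_def by blast
  have wl: "(\<lambda>n. w (s n)) \<longlonglongrightarrow> l" using ls(3) by (simp add: o_def)
  have lim: "(\<lambda>n. h (w (s n))) \<longlonglongrightarrow> h l" if "continuous_on C h" for h :: "'a \<Rightarrow> 'c::topological_space"
    by (rule continuous_on_tendsto_compose[OF that wl ls(1)]) (use wv in auto)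
  have "(\<lambda>n. grad R (w n) + v n) \<longlonglongrightarrow> 0"
    by (rule Lim_null_comparison[OF _ LIMSEQ_inverse_real_of_nat]) (use wv(4) in \<open>auto intro!: always_eventually less_imp_le\<close>)
  then have "(\<lambda>n. grad R (w (s n)) + v (s n)) \<longlonglongrightarrow> 0"
    by (drule_tac LIMSEQ_subseq_LIMSEQ[OF _ ls(2)]) (simp add: o_def)
  from tendsto_diff[OF this lim[OF R(2)]] have v: "(\<lambda>n. v (s n)) \<longlonglongrightarrow> - grad R l" by simp
  have "inner (- grad R l) (u - l) \<le> 0" if "u \<in> C" for u
  proof (rule tendsto_upperbound)
    show "(\<lambda>n. inner (v (s n)) (u - w (s n))) \<longlonglongrightarrow> inner (- grad R l) (u - l)"
      by (intro tendsto_intros v wl)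
  qed (use wv(3) that in \<open>auto simp: normal_cone_def\<close>)
  then have "- grad R l \<in> normal_cone C l" using ls(1) by (auto simp: normal_cone_def)
  moreover have "R l \<ge> 0"
    by (rule tendsto_lowerbound[OF lim[OF R(1)]]) (use wv(2) in auto)
  ultimately show False using cq ls(1) unfolding ENNAMCQ_def
    by (metis (no_types, lifting) add.right_inverse image_eqI)
qed

section \<open>The regularized residual\<close>

locale ivsp_setting = ivsp_algorithm X Y f g \<sigma> \<rho> \<delta> L_f L_xy L_R B_R \<phi> a1 a2 b_phi c1 c2
    theta_low theta_hat w0 \<mu> \<zeta> grid rule
  for X :: "'a::euclidean_space set" and Y :: "'b::euclidean_space set"
    and f g \<sigma> \<rho> \<delta> L_f L_xy L_R B_R \<phi> a1 a2 b_phi c1 c2 theta_low theta_hat w0 \<mu> \<zeta> grid rule +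
  fixes c_phi r q zeta_bar :: real
  assumes X: "compact X" "convex X"
    and Y: "Y \<noteq> {}" "compact Y" "convex Y"
    and f: "C1_near (X \<times> Y) f" "L_f-lipschitz_on (X \<times> Y) (grad f)"
    and g: "C1_near (X \<times> Y) g"
    and weak_convexity: "\<forall>x\<in>X. convex_on Y (\<lambda>y. g (x, y) + \<sigma> / 2 * (norm y)\<^sup>2)"
    and reg: "\<rho> > 0" "\<rho> * \<sigma> < 1"
    and L_xy: "\<forall>x\<in>X. L_xy-lipschitz_on Y (\<lambda>y. fst (grad g (x, y)))"
    and L_R: "L_R-lipschitz_on (X \<times> Y) (grad (residual Y g \<rho> \<delta>))"
    and B_R: "B_R > 0" "\<forall>w\<in>X \<times> Y. norm (grad (residual Y g \<rho> \<delta>) w) \<le> B_R"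
    and smoothing: "smoothing \<phi> a1 a2 b_phi c_phi" "a1 + a2 > 0"
    and params: "c1 > 0" "c2 > 0" "theta_low > 0" "0 < theta_hat" "theta_hat < 2" "w0 \<in> X \<times> Y"
    and mu: "\<And>k. \<mu> k > 0" "decseq \<mu>" "\<mu> \<longlonglongrightarrow> 0"
    and zeta: "\<And>k. \<zeta> k > 0" "decseq \<zeta>"
    and grid: "\<And>t. grid t > 0" "decseq grid" "grid \<longlonglongrightarrow> 0"
    and ennamcq: "ENNAMCQ (X \<times> Y) (residual Y g \<rho> \<delta>)"
    and mu_rate: "0 < r" "r < 1" "\<mu> \<in> \<Theta>(\<lambda>k. (1 + real k) powr (- r))"
    and zeta_rate: "zeta_bar > 0" "q > 1 / r" "\<And>k. \<zeta> k \<le> zeta_bar * \<mu> k powr q"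
begin

abbreviation C where "C \<equiv> X \<times> Y"
abbreviation R where "R \<equiv> residual Y g \<rho> \<delta>"

definition lower :: "'a \<times> 'b \<Rightarrow> 'b" where
  "lower w = (SOME z. z \<in> Y \<and> (\<forall>z'\<in>Y. psi g \<rho> z w \<le> psi g \<rho> z' w))"

definition grad_G :: "real \<Rightarrow> 'a \<times> 'b \<Rightarrow> 'a \<times> 'b" where
  "grad_G m w = deriv (\<phi> m) (R w) *\<^sub>R grad R w"

lemma compact_C: "compact C" and convex_C: "convex C" and closed_C: "closed C"
  using X Y by (auto simp: compact_Times convex_Times compact_imp_closed closed_Times)

lemma mu_le: "\<mu> k \<le> \<mu> 0" and zeta_Suc: "\<zeta> (Suc k) \<le> \<zeta> k" and grid_le: "grid t \<le> grid 0"
  using mu(2) zeta(2) grid(2) by (simp_all add: decseq_def)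

lemma L_f_nonneg: "0 \<le> L_f" and L_R_nonneg: "0 \<le> L_R" and b_phi_nonneg: "0 \<le> b_phi"
  using f(2) L_R smoothing(1) by (auto simp: lipschitz_on_nonneg smoothing_def)

lemma L_G_nonneg: "0 \<le> L_G"
  unfolding L_G_def using L_R_nonneg b_phi_nonneg mu(1)[of 0] by simp

lemma modulus_pos: "1 / \<rho> - \<sigma> > 0"
  using reg by (simp add: field_simps)

lemma f_gderiv: "w \<in> C \<Longrightarrow> GDERIV f w :> grad f w"
  using f(1) unfolding C1_near_def by (meson gderiv_grad subsetD)

lemma g_nbhd:
  obtains U where "open U" "C \<subseteq> U" "\<And>w. w \<in> U \<Longrightarrow> GDERIV g w :> grad g w" "continuous_on U (grad g)"
  using g unfolding C1_near_def by (meson gderiv_grad)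

lemma psi_continuous:
  assumes "\<And>z. z \<in> Y \<Longrightarrow> GDERIV g (fst w, z) :> grad g (fst w, z)"
  shows "continuous_on Y (\<lambda>z. psi g \<rho> z w)"
proof -
  have "continuous_on (Pair (fst w) ` Y) g"
    using assms by (intro gderiv_continuous_on[of _ _ "grad g"]) auto
  then have "continuous_on Y (\<lambda>z. g (fst w, z))"
    by (rule continuous_on_compose2) (auto intro!: continuous_intros)
  then show ?thesis unfolding psi_def by (intro continuous_intros)
qed

lemma psi_gderiv:
  assumes "GDERIV g (fst w, z) :> grad g (fst w, z)"
  shows "GDERIV (psi g \<rho> z) w :> (fst (grad g (fst w, z)), (1 / \<rho>) *\<^sub>R (snd w - z))"
proof -
  have g': "(g has_derivative (\<lambda>h. inner h (grad g (fst w, z)))) (at (fst w, z))"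
    using assms by (simp add: gderiv_def)
  have "((\<lambda>w. (fst w, z)) has_derivative (\<lambda>h. (fst h, 0))) (at w)"
    by (auto intro!: derivative_eq_intros)
  from has_derivative_compose[OF this g']
  have "((\<lambda>w. g (fst w, z)) has_derivative (\<lambda>h. inner (fst h, 0) (grad g (fst w, z)))) (at w)" .
  moreover have "((\<lambda>w. (norm (z - snd w))\<^sup>2) has_derivative (\<lambda>h. - 2 * inner (snd h) (z - snd w))) (at w)"
    unfolding power2_norm_eq_inner by (auto intro!: derivative_eq_intros simp: inner_commute)
  ultimately have "((\<lambda>w. g (fst w, z) + 1 / (2 * \<rho>) * (norm (z - snd w))\<^sup>2) has_derivative
     (\<lambda>h. inner (fst h, 0) (grad g (fst w, z)) + 1 / (2 * \<rho>) * (- 2 * inner (snd h) (z - snd w)))) (at w)"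
    by (intro has_derivative_add has_derivative_mult_right)
  then show ?thesis unfolding gderiv_def psi_def
    using reg(1) by (elim has_derivative_eq_rhs)
      (auto simp: inner_prod_def fun_eq_iff inner_diff_right field_simps)
qed

lemma lower_in: "w \<in> C \<Longrightarrow> lower w \<in> Y"
  and lower_le: "w \<in> C \<Longrightarrow> z \<in> Y \<Longrightarrow> psi g \<rho> (lower w) w \<le> psi g \<rho> z w"
proof -
  assume w: "w \<in> C"
  obtain U where U: "C \<subseteq> U" "\<And>w. w \<in> U \<Longrightarrow> GDERIV g w :> grad g w" using g_nbhd by metis
  have "continuous_on Y (\<lambda>z. psi g \<rho> z w)"
    by (rule psi_continuous, rule U(2)) (use w U(1) in auto)
  then have "\<exists>z. z \<in> Y \<and> (\<forall>z'\<in>Y. psi g \<rho> z w \<le> psi g \<rho> z' w)"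
    using continuous_attains_inf[OF Y(2,1)] by blast
  from someI_ex[OF this] show "lower w \<in> Y" "z \<in> Y \<Longrightarrow> psi g \<rho> (lower w) w \<le> psi g \<rho> z w"
    unfolding lower_def by blast+
qed

lemma g_reg_eq: "w \<in> C \<Longrightarrow> g_reg Y g \<rho> w = psi g \<rho> (lower w) w"
  unfolding g_reg_def using lower_in lower_le by (intro cInf_eq_minimum) auto

lemma psi_growth:
  assumes "w \<in> C" "z \<in> Y"
  shows "psi g \<rho> (lower w) w + (1 / \<rho> - \<sigma>) / 2 * (norm (z - lower w))\<^sup>2 \<le> psi g \<rho> z w"
proof (rule quadratic_growth[where F = "\<lambda>z. psi g \<rho> z w" and Y = Y])
  have "convex_on Y (\<lambda>z. 1 / (2 * \<rho>) * (norm (snd w))\<^sup>2 - inner z (snd w) / \<rho>)"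
  proof (rule convex_onI)
    fix s x y
    show "1 / (2 * \<rho>) * (norm (snd w))\<^sup>2 - inner ((1 - s) *\<^sub>R x + s *\<^sub>R y) (snd w) / \<rho>
      \<le> (1 - s) * (1 / (2 * \<rho>) * (norm (snd w))\<^sup>2 - inner x (snd w) / \<rho>)
       + s * (1 / (2 * \<rho>) * (norm (snd w))\<^sup>2 - inner y (snd w) / \<rho>)"
      by (simp add: inner_simps algebra_simps add_divide_distrib diff_divide_distrib)
  qed (rule Y(3))
  moreover have "convex_on Y (\<lambda>y. g (fst w, y) + \<sigma> / 2 * (norm y)\<^sup>2)"
    using weak_convexity assms by auto
  ultimately have "convex_on Y (\<lambda>z. (g (fst w, z) + \<sigma> / 2 * (norm z)\<^sup>2)
      + (1 / (2 * \<rho>) * (norm (snd w))\<^sup>2 - inner z (snd w) / \<rho>))"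
    by (rule convex_on_add[rotated])
  moreover have "(g (fst w, z) + \<sigma> / 2 * (norm z)\<^sup>2)
      + (1 / (2 * \<rho>) * (norm (snd w))\<^sup>2 - inner z (snd w) / \<rho>)
      = psi g \<rho> z w - (1 / \<rho> - \<sigma>) / 2 * (norm z)\<^sup>2" for z
    unfolding psi_def power2_norm_eq_inner using reg(1)
    by (simp add: inner_simps inner_commute field_simps)
  ultimately show "convex_on Y (\<lambda>z. psi g \<rho> z w - (1 / \<rho> - \<sigma>) / 2 * (norm z)\<^sup>2)" by simp
qed (use assms lower_in lower_le in auto)

lemma R_gderiv:
  assumes w: "w \<in> C"
  shows "GDERIV R w :> approx_grad_residual g \<rho> (lower w) w"
proof -
  obtain U where U: "open U" "C \<subseteq> U" "\<And>w. w \<in> U \<Longrightarrow> GDERIV g w :> grad g w"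
    "continuous_on U (grad g)" using g_nbhd by metis
  have "compact ({fst w} \<times> Y)" using Y(2) by (simp add: compact_Times)
  moreover have "{fst w} \<times> Y \<subseteq> U" using w U(2) by auto
  ultimately obtain e where e: "e > 0" "(\<Union>p\<in>{fst w} \<times> Y. cball p e) \<subseteq> U"
    using compact_subset_open_imp_cball_epsilon_subset U(1) by metis
  have inU: "(fst v, z) \<in> U" if "v \<in> cball w e" "z \<in> Y" for v z
  proof -
    have "dist (fst w) (fst v) \<le> e" using that(1) dist_fst_le[of w v] by simp
    then have "(fst v, z) \<in> cball (fst w, z) e" by (simp add: dist_Pair_Pair)
    then show ?thesis using e(2) that(2) by blast
  qed
  have "GDERIV (\<lambda>v. INF z\<in>Y. psi g \<rho> z v) w :>
      (fst (grad g (fst w, lower w)), (1 / \<rho>) *\<^sub>R (snd w - lower w))"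
  proof (rule danskin[OF Y(2) lower_in[OF w] e(1)])
    show "GDERIV (psi g \<rho> z) v :> (fst (grad g (fst v, z)), (1 / \<rho>) *\<^sub>R (snd v - z))"
      if "z \<in> Y" "v \<in> cball w e" for z v
      using that by (intro psi_gderiv U(3) inU)
    show "continuous_on Y (\<lambda>z. psi g \<rho> z v)" if "v \<in> cball w e" for v
      using that by (intro psi_continuous U(3) inU)
    have "continuous_on (Y \<times> cball w e) (\<lambda>x. grad g (fst (snd x), fst x))"
      using inU by (intro continuous_on_compose2[OF U(4)]) (auto intro!: continuous_intros)
    then show "continuous_on (Y \<times> cball w e)
        (\<lambda>(z, v). (fst (grad g (fst v, z)), (1 / \<rho>) *\<^sub>R (snd v - z)))"
      unfolding case_prod_unfold by (intro continuous_intros)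
    show "psi g \<rho> (lower w) w < psi g \<rho> z w" if "z \<in> Y" "z \<noteq> lower w" for z
    proof -
      have "0 < (1 / \<rho> - \<sigma>) / 2 * (norm (z - lower w))\<^sup>2"
        using modulus_pos that(2) by simp
      then show ?thesis using psi_growth[OF w that(1)] by linarith
    qed
  qed
  then have "GDERIV (g_reg Y g \<rho>) w :>
      (fst (grad g (fst w, lower w)), (1 / \<rho>) *\<^sub>R (snd w - lower w))"
    by (simp add: g_reg_def[abs_def])
  moreover have "GDERIV g w :> grad g w" using U w by blast
  ultimately have "GDERIV (\<lambda>w. g w - g_reg Y g \<rho> w - \<delta>) w :>
      grad g w - (fst (grad g (fst w, lower w)), (1 / \<rho>) *\<^sub>R (snd w - lower w)) - 0"
    by (intro GDERIV_diff GDERIV_const)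
  then show ?thesis
    unfolding residual_def[abs_def] approx_grad_residual_def by (simp add: minus_prod_def)
qed

lemma grad_R: "w \<in> C \<Longrightarrow> grad R w = approx_grad_residual g \<rho> (lower w) w"
  by (rule grad_eq[OF R_gderiv])

lemma R_gderiv_grad: "w \<in> C \<Longrightarrow> GDERIV R w :> grad R w"
  by (simp add: R_gderiv grad_R)

lemma R_diff_le: "w \<in> C \<Longrightarrow> v \<in> C \<Longrightarrow> \<bar>R w - R v\<bar> \<le> B_R * norm (w - v)"
  using R_gderiv_grad B_R(2) by (intro gderiv_norm_diff_le[OF convex_C]) auto

lemma accurate_residual:
  assumes "accurate Y g \<rho> s z w"
  shows "approx_residual g \<rho> \<delta> z w \<le> R w" "R w \<le> approx_residual g \<rho> \<delta> z w + s"
  using assms by (simp_all add: accurate_def approx_residual_def residual_def)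

lemma accurate_dist:
  assumes "accurate Y g \<rho> s z w" "w \<in> C"
  shows "norm (z - lower w) \<le> sqrt (2 * s / (1 / \<rho> - \<sigma>))"
proof (rule real_le_rsqrt)
  have "(1 / \<rho> - \<sigma>) / 2 * (norm (z - lower w))\<^sup>2 \<le> s"
    using psi_growth[OF assms(2), of z] assms(1) unfolding accurate_def g_reg_eq[OF assms(2)] by linarith
  then show "(norm (z - lower w))\<^sup>2 \<le> 2 * s / (1 / \<rho> - \<sigma>)"
    using modulus_pos by (simp add: pos_le_divide_eq mult.commute)
qed

lemma accurate_grad:
  assumes "accurate Y g \<rho> s z w" "w \<in> C"
  shows "norm (approx_grad_residual g \<rho> z w - grad R w) \<le> D_err s"
proof -
  let ?n = "norm (z - lower w)"
  have zY: "z \<in> Y" using assms(1) by (simp add: accurate_def)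
  have x: "norm (fst (grad g (fst w, lower w)) - fst (grad g (fst w, z))) \<le> L_xy * ?n"
  proof -
    have "fst w \<in> X" using assms(2) by auto
    with L_xy have "L_xy-lipschitz_on Y (\<lambda>y. fst (grad g (fst w, y)))" by blast
    from lipschitz_on_normD[OF this lower_in[OF assms(2)] zY] show ?thesis
      by (simp add: norm_minus_commute)
  qed
  have "approx_grad_residual g \<rho> z w - grad R w =
    (fst (grad g (fst w, lower w)) - fst (grad g (fst w, z)), (1 / \<rho>) *\<^sub>R (z - lower w))"
    unfolding grad_R[OF assms(2)] approx_grad_residual_def by (simp add: algebra_simps)
  then have "norm (approx_grad_residual g \<rho> z w - grad R w) =
      sqrt ((norm (fst (grad g (fst w, lower w)) - fst (grad g (fst w, z))))\<^sup>2 + (norm ((1 / \<rho>) *\<^sub>R (z - lower w)))\<^sup>2)"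
    by (simp add: norm_Pair)
  also have "\<dots> \<le> sqrt ((L_xy * ?n)\<^sup>2 + (1 / \<rho> * ?n)\<^sup>2)"
    using x reg(1) by (intro real_sqrt_le_mono add_mono power_mono) auto
  also have "\<dots> = sqrt (L_xy\<^sup>2 + (1 / \<rho>)\<^sup>2) * ?n"
    unfolding power_mult_distrib distrib_right[symmetric] by (simp add: real_sqrt_mult)
  also have "\<dots> \<le> D_err s"
    unfolding D_err_def using accurate_dist[OF assms] by (intro mult_left_mono) auto
  finally show ?thesis .
qed

section \<open>One step of the algorithm\<close>

lemma G_gderiv:
  assumes "w \<in> C" "m > 0"
  shows "GDERIV (\<lambda>w. \<phi> m (R w)) w :> grad_G m w"
  unfolding grad_G_def
  using GDERIV_DERIV_compose[OF R_gderiv_grad[OF assms(1)] smoothing_DERIV[OF smoothing(1) assms(2)]] .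

lemma scaled_grad_R_diff:
  assumes "v \<in> C" "m > 0" "w \<in> C"
  shows "norm (deriv (\<phi> m) s *\<^sub>R grad R v - deriv (\<phi> m) t *\<^sub>R grad R w) \<le>
    L_R * norm (v - w) + b_phi * B_R / m * \<bar>s - t\<bar>"
proof -
  have gw: "norm (grad R w) \<le> B_R" by (rule bspec[OF B_R(2) assms(3)])
  have gl: "norm (grad R v - grad R w) \<le> L_R * norm (v - w)"
    by (rule lipschitz_on_normD[OF L_R assms(1,3)])
  have d1: "\<bar>deriv (\<phi> m) s\<bar> \<le> 1"
    using smoothing_deriv_bounds[OF smoothing(1) assms(2), of s] by (simp add: abs_le_iff)
  have d2: "\<bar>deriv (\<phi> m) s - deriv (\<phi> m) t\<bar> \<le> b_phi / m * \<bar>s - t\<bar>"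
    by (rule smoothing_deriv_bounds(3)[OF smoothing(1) assms(2)])
  have d3: "0 \<le> b_phi / m * \<bar>s - t\<bar>" using assms(2) b_phi_nonneg by simp
  have eq: "deriv (\<phi> m) s *\<^sub>R grad R v - deriv (\<phi> m) t *\<^sub>R grad R w =
      deriv (\<phi> m) s *\<^sub>R (grad R v - grad R w) + (deriv (\<phi> m) s - deriv (\<phi> m) t) *\<^sub>R grad R w"
    by (simp add: algebra_simps)
  have "norm (deriv (\<phi> m) s *\<^sub>R grad R v - deriv (\<phi> m) t *\<^sub>R grad R w)
      \<le> \<bar>deriv (\<phi> m) s\<bar> * norm (grad R v - grad R w) + \<bar>deriv (\<phi> m) s - deriv (\<phi> m) t\<bar> * norm (grad R w)"
    unfolding eq by (rule norm_triangle_le) (simp only: norm_scaleR order_refl)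
  also have "\<dots> \<le> 1 * (L_R * norm (v - w)) + b_phi / m * \<bar>s - t\<bar> * B_R"
    by (rule add_mono[OF mult_mono[OF d1 gl] mult_mono[OF d2 gw]]) (use d3 in simp_all)
  finally show ?thesis by (simp add: mult.commute mult.left_commute)
qed

lemma G_lipschitz:
  assumes "m > 0" "m \<le> \<mu> 0"
  shows "(L_G / m)-lipschitz_on C (grad_G m)"
proof (rule lipschitz_onI)
  fix v w assume vw: "v \<in> C" "w \<in> C"
  have "norm (grad_G m v - grad_G m w) \<le> L_R * norm (v - w) + b_phi * B_R / m * \<bar>R v - R w\<bar>"
    unfolding grad_G_def by (rule scaled_grad_R_diff[OF vw(1) assms(1) vw(2)])
  also have "\<dots> \<le> L_R * norm (v - w) + b_phi * B_R / m * (B_R * norm (v - w))"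
    using R_diff_le[OF vw] b_phi_nonneg B_R assms(1) by (intro add_left_mono mult_left_mono) auto
  also have "\<dots> = (b_phi * B_R\<^sup>2 + m * L_R) / m * norm (v - w)"
    using assms(1) by (simp add: field_simps power2_eq_square)
  also have "\<dots> \<le> L_G / m * norm (v - w)"
    unfolding L_G_def using assms L_R_nonneg
    by (intro mult_right_mono divide_right_mono add_left_mono) auto
  finally show "dist (grad_G m v) (grad_G m w) \<le> L_G / m * dist v w" by (simp add: dist_norm)
qed (use assms L_G_nonneg in simp)

lemma approx_grad_G_err:
  assumes "accurate Y g \<rho> s z w" "w \<in> C"
  shows "norm (approx_grad_G k z w - grad_G (\<mu> k) w) \<le> E_err (\<mu> k) s"
proof -
  let ?s = "approx_residual g \<rho> \<delta> z w" and ?d = "deriv (\<phi> (\<mu> k))"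
  have eq: "approx_grad_G k z w - grad_G (\<mu> k) w =
     ?d ?s *\<^sub>R (approx_grad_residual g \<rho> z w - grad R w) + (?d ?s *\<^sub>R grad R w - ?d (R w) *\<^sub>R grad R w)"
    by (simp add: approx_grad_G_def grad_G_def algebra_simps)
  have "norm (approx_grad_G k z w - grad_G (\<mu> k) w) \<le> \<bar>?d ?s\<bar> * norm (approx_grad_residual g \<rho> z w - grad R w)
      + norm (?d ?s *\<^sub>R grad R w - ?d (R w) *\<^sub>R grad R w)"
    unfolding eq by (rule norm_triangle_le) (simp only: norm_scaleR order_refl)
  also have "\<dots> \<le> 1 * D_err s + b_phi * B_R / \<mu> k * s"
  proof (intro add_mono mult_mono)
    have "\<bar>?s - R w\<bar> \<le> s" using accurate_residual[OF assms(1)] by simp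
    then have "b_phi * B_R / \<mu> k * \<bar>?s - R w\<bar> \<le> b_phi * B_R / \<mu> k * s"
      using b_phi_nonneg B_R(1) mu(1)[of k] by (intro mult_left_mono) auto
    then show "norm (?d ?s *\<^sub>R grad R w - ?d (R w) *\<^sub>R grad R w) \<le> b_phi * B_R / \<mu> k * s"
      using scaled_grad_R_diff[OF assms(2) mu(1)[of k] assms(2), of ?s "R w"] by simp
  qed (use accurate_grad[OF assms] smoothing_deriv_bounds[OF smoothing(1) mu(1)] in auto)
  finally show ?thesis by (simp add: E_err_def)
qed

lemma trial_in: "trial k t w z L \<in> C"
  unfolding trial_def using params(6) closed_C by (intro closest_point_in_set) auto

lemma trial_normal_cone:
  assumes "L > 0" and wp: "wp = trial k t w z L"
  shows "- (L / \<mu> k) *\<^sub>R (wp - w) - (grid t *\<^sub>R grad f w + approx_grad_G k z w) \<in> normal_cone C wp"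
proof -
  let ?v = "grid t *\<^sub>R grad f w + approx_grad_G k z w"
  have "inner (- (L / \<mu> k) *\<^sub>R (wp - w) - ?v) (u - wp) \<le> 0" if "u \<in> C" for u
  proof -
    have "inner (w - (\<mu> k / L) *\<^sub>R ?v - wp) (u - wp) \<le> 0"
      unfolding wp trial_def by (rule closest_point_dot[OF convex_C closed_C that])
    then have "L / \<mu> k * inner (w - (\<mu> k / L) *\<^sub>R ?v - wp) (u - wp) \<le> 0"
      using assms(1) mu(1)[of k] by (intro mult_nonneg_nonpos) auto
    moreover have "(L / \<mu> k) *\<^sub>R (w - (\<mu> k / L) *\<^sub>R ?v - wp) = - (L / \<mu> k) *\<^sub>R (wp - w) - ?v"
    proof -
      have "(L / \<mu> k) *\<^sub>R ((\<mu> k / L) *\<^sub>R ?v) = ?v" using assms(1) mu(1)[of k] by simp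
      then show ?thesis
        by (simp only: scaleR_diff_right scaleR_minus_left)
          (simp add: algebra_simps)
    qed
    ultimately show ?thesis by (metis inner_scaleR_left)
  qed
  then show ?thesis using trial_in wp by (simp add: normal_cone_def)
qed

lemma theta_pos: "theta k L d > 0"
  unfolding theta_def using params(3) by (simp add: max_def)

lemma accept_if_large:
  assumes w: "w \<in> C" "accurate Y g \<rho> (\<zeta> k) z w"
    and L: "L_safe \<le> L" and zp: "accurate Y g \<rho> (\<zeta> (Suc k)) zp (trial k t w z L)"
  shows "accept k t w z L zp"
proof -
  define wp where "wp = trial k t w z L"
  define d where "d = norm (wp - w)"
  define m where "m = \<mu> k"
  define E where "E = E_err m (\<zeta> k)"
  define v where "v = grid t *\<^sub>R grad f w + approx_grad_G k z w"
  define th where "th = theta k L d"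
  have m: "m > 0" "m \<le> \<mu> 0" using mu(1) mu_le by (simp_all add: m_def)
  have th: "th > 0" using theta_pos by (simp add: th_def)
  have wp: "wp \<in> C" using trial_in by (simp add: wp_def)
  have L1: "theta_low \<le> theta_hat * L"
    using L params by (simp add: L_safe_def pos_divide_le_eq mult.commute)
  have L0: "L > 0"
    using L1 params by (metis less_le_trans zero_less_mult_pos)
  have "c1 + grid 0 * \<mu> 0 * L_f + L_G \<le> (2 - theta_hat) * L"
    using L params by (simp add: L_safe_def pos_divide_le_eq mult.commute)
  moreover have "grid t * m * L_f \<le> grid 0 * \<mu> 0 * L_f"
    using m grid_le grid(1) L_f_nonneg by (intro mult_right_mono mult_mono) (auto intro: less_imp_le)
  moreover have "th \<le> theta_hat * L" unfolding th_def theta_def using L1 by simp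
  ultimately have coef: "c1 + grid t * m * L_f + L_G + th \<le> 2 * L" by (simp add: algebra_simps)
  have fd: "f wp \<le> f w + inner (wp - w) (grad f w) + L_f / 2 * d\<^sup>2"
    unfolding d_def by (rule descent_lemma[OF convex_C f_gderiv f(2) w(1) wp])
  have Gd: "\<phi> m (R wp) \<le> \<phi> m (R w) + inner (wp - w) (grad_G m w) + L_G / m / 2 * d\<^sup>2"
    unfolding d_def by (rule descent_lemma[OF convex_C G_gderiv[OF _ m(1)] G_lipschitz[OF m] w(1) wp])
  have "- (L / m) *\<^sub>R (wp - w) - v \<in> normal_cone C wp"
    unfolding v_def m_def by (rule trial_normal_cone[OF L0 wp_def])
  then have "inner (- (L / m) *\<^sub>R (wp - w) - v) (w - wp) \<le> 0"
    using w(1) unfolding normal_cone_def by blast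
  moreover have "inner (- (L / m) *\<^sub>R (wp - w) - v) (w - wp) = L / m * inner (wp - w) (wp - w) + inner (wp - w) v"
    by (simp add: inner_diff_left inner_diff_right inner_commute algebra_simps)
  ultimately have opt: "inner (wp - w) v \<le> - (L / m) * d\<^sup>2"
    by (simp add: d_def power2_norm_eq_inner)
  have "inner (wp - w) (grad_G m w - approx_grad_G k z w) \<le> d * norm (grad_G m w - approx_grad_G k z w)"
    unfolding d_def by (rule norm_cauchy_schwarz)
  also have "\<dots> \<le> d * E"
    using approx_grad_G_err[OF w(2,1), of k] by (simp add: m_def d_def E_def mult_left_mono norm_minus_commute)
  also have "\<dots> \<le> th / (2 * m) * d\<^sup>2 + m / (2 * th) * E\<^sup>2"
  proof -
    have "0 \<le> (th * d - m * E)\<^sup>2 / (2 * m * th)" using m th by simp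
    also have "\<dots> = th / (2 * m) * d\<^sup>2 + m / (2 * th) * E\<^sup>2 - d * E"
      using m th by (simp add: field_simps power2_eq_square)
    finally show ?thesis by simp
  qed
  finally have err: "inner (wp - w) (grad_G m w - approx_grad_G k z w) \<le> th / (2 * m) * d\<^sup>2 + m / (2 * th) * E\<^sup>2" .
  have "grid t * f wp \<le> grid t * (f w + inner (wp - w) (grad f w) + L_f / 2 * d\<^sup>2)"
    using fd grid(1)[of t] by simp
  moreover have "inner (wp - w) v = grid t * inner (wp - w) (grad f w) + inner (wp - w) (approx_grad_G k z w)"
    by (simp add: v_def inner_add_right)
  ultimately have "grid t * f wp + \<phi> m (R wp) \<le> grid t * f w + \<phi> m (R w) + m / (2 * th) * E\<^sup>2
      + (th / (2 * m) * d\<^sup>2 - L / m * d\<^sup>2 + grid t * L_f / 2 * d\<^sup>2 + L_G / m / 2 * d\<^sup>2)"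
    using Gd opt err by (simp add: inner_diff_right algebra_simps)
  also have "th / (2 * m) * d\<^sup>2 - L / m * d\<^sup>2 + grid t * L_f / 2 * d\<^sup>2 + L_G / m / 2 * d\<^sup>2
      = (th + grid t * m * L_f + L_G - 2 * L) / (2 * m) * d\<^sup>2"
    using m by (simp add: field_simps)
  also have "\<dots> \<le> - c1 / (2 * m) * d\<^sup>2"
    using coef m by (intro mult_right_mono divide_right_mono) auto
  finally have main: "grid t * f wp + \<phi> m (R wp) \<le> grid t * f w + \<phi> m (R w) + m / (2 * th) * E\<^sup>2 - c1 / (2 * m) * d\<^sup>2"
    by simp
  have "\<phi> m (approx_residual g \<rho> \<delta> zp wp + \<zeta> (Suc k)) \<le> \<phi> m (R wp + \<zeta> (Suc k))"
    using accurate_residual[OF zp] by (intro smoothing_mono[OF smoothing(1) m(1)]) (simp add: wp_def)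
  also have "\<dots> \<le> \<phi> m (R wp) + \<zeta> (Suc k)"
    using smoothing_nonexpansive[OF smoothing(1) m(1), of "R wp" "R wp + \<zeta> (Suc k)"] zeta(1)[of "Suc k"] by simp
  finally have 1: "\<phi> m (approx_residual g \<rho> \<delta> zp wp + \<zeta> (Suc k)) \<le> \<phi> m (R wp) + \<zeta> (Suc k)" .
  have "\<phi> m (R w) \<le> \<phi> m (approx_residual g \<rho> \<delta> z w + \<zeta> k)"
    using accurate_residual[OF w(2)] by (intro smoothing_mono[OF smoothing(1) m(1)]) simp
  also have "\<dots> \<le> \<phi> m (approx_residual g \<rho> \<delta> z w) + \<zeta> k"
    using smoothing_nonexpansive[OF smoothing(1) m(1), of "approx_residual g \<rho> \<delta> z w" "approx_residual g \<rho> \<delta> z w + \<zeta> k"] zeta(1)[of k] by simp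
  finally have 2: "\<phi> m (R w) \<le> \<phi> m (approx_residual g \<rho> \<delta> z w) + \<zeta> k" .
  have "grid t * f wp + \<phi> m (approx_residual g \<rho> \<delta> zp wp + \<zeta> (Suc k)) \<le> grid t * f w
      + \<phi> m (approx_residual g \<rho> \<delta> z w) - c1 / (2 * m) * d\<^sup>2 + (m / (2 * th) * E\<^sup>2 + \<zeta> k + \<zeta> (Suc k))"
    using main 1 2 by linarith
  then show ?thesis
    unfolding accept_def Let_def tau_def wp_def[symmetric] d_def[symmetric] th_def[symmetric]
      m_def[symmetric] E_def[symmetric] by simp
qed

definition stat_err :: "nat \<Rightarrow> real" where
  "stat_err k = E_err (\<mu> k) (\<zeta> k) + b_phi * B_R / \<mu> k * \<zeta> k"

lemma step_stationarity:
  assumes w: "w \<in> C" "accurate Y g \<rho> (\<zeta> k) z w" and L: "0 < L"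
    and wp: "wp = trial k t w z L" and zp: "accurate Y g \<rho> (\<zeta> (Suc k)) zp wp"
  obtains v where "v \<in> normal_cone C wp"
    "norm (grid t *\<^sub>R grad f wp + deriv (\<phi> (\<mu> k)) (approx_residual g \<rho> \<delta> zp wp) *\<^sub>R grad R wp + v)
      \<le> (L + grid 0 * \<mu> 0 * L_f + L_G) * (norm (wp - w) / \<mu> k) + stat_err k"
proof
  let ?v = "- (L / \<mu> k) *\<^sub>R (wp - w) - (grid t *\<^sub>R grad f w + approx_grad_G k z w)"
  let ?s = "approx_residual g \<rho> \<delta> zp wp" and ?d = "norm (wp - w)"
  have m: "\<mu> k > 0" "\<mu> k \<le> \<mu> 0" using mu(1) mu_le by simp_all
  have wpC: "wp \<in> C" using trial_in wp by simp
  show "?v \<in> normal_cone C wp" by (rule trial_normal_cone[OF L wp])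
  have n1: "norm (- (L / \<mu> k) *\<^sub>R (wp - w)) = L * (?d / \<mu> k)" using L m by simp
  have "norm (grid t *\<^sub>R (grad f wp - grad f w)) \<le> grid t * (L_f * ?d)"
    using lipschitz_on_normD[OF f(2) wpC w(1)] grid(1)[of t] by (simp add: mult_left_mono)
  also have "\<dots> = grid t * \<mu> k * L_f * (?d / \<mu> k)" using m by simp
  also have "\<dots> \<le> grid 0 * \<mu> 0 * L_f * (?d / \<mu> k)"
    using m grid_le grid(1) L_f_nonneg by (intro mult_right_mono mult_mono) (auto intro: less_imp_le)
  finally have n2: "norm (grid t *\<^sub>R (grad f wp - grad f w)) \<le> grid 0 * \<mu> 0 * L_f * (?d / \<mu> k)" .
  have "norm (deriv (\<phi> (\<mu> k)) ?s *\<^sub>R grad R wp - deriv (\<phi> (\<mu> k)) (R wp) *\<^sub>R grad R wp)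
      \<le> b_phi * B_R / \<mu> k * \<bar>?s - R wp\<bar>"
    using scaled_grad_R_diff[OF wpC m(1) wpC, of ?s "R wp"] by simp
  also have "\<dots> \<le> b_phi * B_R / \<mu> k * \<zeta> k"
    using accurate_residual[OF zp] zeta_Suc[of k] b_phi_nonneg B_R(1) m
    by (intro mult_left_mono) auto
  finally have n3: "norm (deriv (\<phi> (\<mu> k)) ?s *\<^sub>R grad R wp - grad_G (\<mu> k) wp) \<le> b_phi * B_R / \<mu> k * \<zeta> k"
    by (simp add: grad_G_def)
  have n4: "norm (grad_G (\<mu> k) wp - grad_G (\<mu> k) w) \<le> L_G * (?d / \<mu> k)"
    using lipschitz_on_normD[OF G_lipschitz[OF m] wpC w(1)] by simp
  have n5: "norm (grad_G (\<mu> k) w - approx_grad_G k z w) \<le> E_err (\<mu> k) (\<zeta> k)"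
    using approx_grad_G_err[OF w(2,1)] by (simp add: norm_minus_commute)
  have eq: "grid t *\<^sub>R grad f wp + deriv (\<phi> (\<mu> k)) ?s *\<^sub>R grad R wp + ?v =
     - (L / \<mu> k) *\<^sub>R (wp - w) + (grid t *\<^sub>R (grad f wp - grad f w)
      + ((deriv (\<phi> (\<mu> k)) ?s *\<^sub>R grad R wp - grad_G (\<mu> k) wp)
      + ((grad_G (\<mu> k) wp - grad_G (\<mu> k) w) + (grad_G (\<mu> k) w - approx_grad_G k z w))))"
    by (simp add: algebra_simps)
  have "norm (grid t *\<^sub>R grad f wp + deriv (\<phi> (\<mu> k)) ?s *\<^sub>R grad R wp + ?v) \<le> L * (?d / \<mu> k) + (grid 0 * \<mu> 0 * L_f * (?d / \<mu> k) +
      (b_phi * B_R / \<mu> k * \<zeta> k + (L_G * (?d / \<mu> k) + E_err (\<mu> k) (\<zeta> k))))"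
    unfolding eq by (intro norm_triangle_mono n2 n3 n4 n5 n1[THEN eq_refl])
  also have "\<dots> = (L + grid 0 * \<mu> 0 * L_f + L_G) * (?d / \<mu> k) + stat_err k"
    by (simp only: distrib_right stat_err_def)
  finally show "norm (grid t *\<^sub>R grad f wp + deriv (\<phi> (\<mu> k)) ?s *\<^sub>R grad R wp + ?v)
      \<le> (L + grid 0 * \<mu> 0 * L_f + L_G) * (?d / \<mu> k) + stat_err k" .
qed

section \<open>Rates of the error terms\<close>

lemma q_gt: "1 < q * r" "1 < q"
proof -
  show "1 < q * r" using zeta_rate(2) mu_rate(1) by (simp add: field_simps)
  have "1 < 1 / r" using mu_rate by simp
  then show "1 < q" using zeta_rate(2) by simp
qed

lemma mu_two_sided:
  obtains l u N where "l > 0" "u > 0"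
    "\<And>k. k \<ge> N \<Longrightarrow> l * (1 + real k) powr (- r) \<le> \<mu> k"
    "\<And>k. k \<ge> N \<Longrightarrow> \<mu> k \<le> u * (1 + real k) powr (- r)"
proof -
  have O: "\<mu> \<in> O(\<lambda>k. (1 + real k) powr (- r))" and Om: "\<mu> \<in> \<Omega>(\<lambda>k. (1 + real k) powr (- r))"
    using mu_rate(3) by (auto simp: bigtheta_def)
  obtain u where u: "u > 0" "eventually (\<lambda>k. norm (\<mu> k) \<le> u * norm ((1 + real k) powr (- r))) at_top"
    using landau_o.bigE[OF O] by blast
  obtain l where l: "l > 0" "eventually (\<lambda>k. norm (\<mu> k) \<ge> l * norm ((1 + real k) powr (- r))) at_top"
    using landau_omega.bigE[OF Om] by blast
  obtain N where N: "\<And>k. k \<ge> N \<Longrightarrow> norm (\<mu> k) \<le> u * norm ((1 + real k) powr (- r)) \<and>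
      norm (\<mu> k) \<ge> l * norm ((1 + real k) powr (- r))"
    using eventually_conj[OF u(2) l(2)] unfolding eventually_at_top_linorder by blast
  show ?thesis
    by (rule that[OF l(1) u(1), of N]) (use N mu(1) in \<open>auto simp: less_imp_le\<close>)
qed

lemma D_err_nonneg: "0 \<le> s \<Longrightarrow> 0 \<le> D_err s"
  unfolding D_err_def using modulus_pos by simp

lemma E_err_bounds: "0 \<le> E_err (\<mu> k) (\<zeta> k)" "E_err (\<mu> k) (\<zeta> k) \<le> stat_err k"
  and stat_err_nonneg: "0 \<le> stat_err k"
proof -
  define x where "x = b_phi * B_R / \<mu> k * \<zeta> k"
  have "0 \<le> x"
    unfolding x_def using b_phi_nonneg B_R(1) mu(1)[of k] zeta(1)[of k] by simp
  with D_err_nonneg[of "\<zeta> k"] zeta(1)[of k] show "0 \<le> E_err (\<mu> k) (\<zeta> k)"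
    "E_err (\<mu> k) (\<zeta> k) \<le> stat_err k" "0 \<le> stat_err k"
    unfolding E_err_def stat_err_def x_def[symmetric] by linarith+
qed

lemma zeta_le_mu: "\<zeta> k \<le> zeta_bar * \<mu> k powr (q - 1) * \<mu> k"
proof -
  have "\<mu> k powr (q - 1) * \<mu> k = \<mu> k powr q"
    using mu(1)[of k] by (simp add: powr_diff)
  then show ?thesis using zeta_rate(3)[of k] by (simp add: mult.assoc)
qed

lemma stat_err_le:
  obtains A where "A \<ge> 0" "\<And>k. stat_err k \<le> A * (\<mu> k powr (q / 2) + \<mu> k powr (q - 1))"
proof -
  define A1 where "A1 = sqrt (L_xy\<^sup>2 + (1 / \<rho>)\<^sup>2) * sqrt (2 * zeta_bar / (1 / \<rho> - \<sigma>))"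
  define A2 where "A2 = 2 * (b_phi * B_R * zeta_bar)"
  have nn: "0 \<le> A1" "0 \<le> A2"
    unfolding A1_def A2_def using modulus_pos zeta_rate(1) b_phi_nonneg B_R(1) by simp_all
  have "stat_err k \<le> (A1 + A2) * (\<mu> k powr (q / 2) + \<mu> k powr (q - 1))" for k
  proof -
    have m: "\<mu> k > 0" by (rule mu(1))
    have "sqrt (2 * \<zeta> k / (1 / \<rho> - \<sigma>)) \<le> sqrt (2 * (zeta_bar * \<mu> k powr q) / (1 / \<rho> - \<sigma>))"
      using zeta_rate(3)[of k] modulus_pos by (intro real_sqrt_le_mono divide_right_mono) auto
    also have "\<dots> = sqrt (2 * zeta_bar / (1 / \<rho> - \<sigma>) * \<mu> k powr q)" by simp
    also have "\<dots> = sqrt (2 * zeta_bar / (1 / \<rho> - \<sigma>)) * \<mu> k powr (q / 2)"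
      unfolding real_sqrt_mult by (simp add: powr_half_sqrt[symmetric] powr_powr)
    finally have "D_err (\<zeta> k) \<le> A1 * \<mu> k powr (q / 2)"
      unfolding D_err_def A1_def mult.assoc by (rule mult_left_mono) simp
    moreover define x where "x = b_phi * B_R / \<mu> k * \<zeta> k"
    have "x \<le> b_phi * B_R * zeta_bar * \<mu> k powr (q - 1)"
    proof -
      have "x \<le> b_phi * B_R / \<mu> k * (zeta_bar * \<mu> k powr (q - 1) * \<mu> k)"
        unfolding x_def using zeta_le_mu[of k] b_phi_nonneg B_R(1) m by (intro mult_left_mono) auto
      also have "\<dots> = b_phi * B_R * zeta_bar * \<mu> k powr (q - 1)" using m by simp
      finally show ?thesis .
    qed
    ultimately have "stat_err k \<le> A1 * \<mu> k powr (q / 2) + 2 * (b_phi * B_R * zeta_bar * \<mu> k powr (q - 1))"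
      unfolding stat_err_def E_err_def x_def[symmetric] by linarith
    then have "stat_err k \<le> A1 * \<mu> k powr (q / 2) + A2 * \<mu> k powr (q - 1)"
      unfolding A2_def by (simp add: mult.assoc)
    also have "\<dots> \<le> (A1 + A2) * \<mu> k powr (q / 2) + (A1 + A2) * \<mu> k powr (q - 1)"
      using nn by (intro add_mono mult_right_mono) auto
    finally show ?thesis by (simp add: distrib_left)
  qed
  with that[of "A1 + A2"] nn show ?thesis by simp
qed

lemma stat_err_tendsto: "stat_err \<longlonglongrightarrow> 0"
proof -
  obtain A where A: "A \<ge> 0" "\<And>k. stat_err k \<le> A * (\<mu> k powr (q / 2) + \<mu> k powr (q - 1))"
    using stat_err_le by blast
  have "(\<lambda>k. A * (\<mu> k powr (q / 2) + \<mu> k powr (q - 1))) \<longlonglongrightarrow> A * (0 + 0)"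
    using mu(1) q_gt(2)
    by (intro tendsto_intros tendsto_zero_powrI[OF mu(3)]) (auto intro: always_eventually less_imp_le)
  then show ?thesis
    using A(2) stat_err_nonneg
    by (intro tendsto_sandwich[OF _ _ tendsto_const, of 0 stat_err]) (auto intro!: always_eventually)
qed

lemma summable_mu_powr: "summable (\<lambda>k. \<mu> k powr q)"
proof -
  obtain l u N where u: "u > 0" "\<And>k. k \<ge> N \<Longrightarrow> \<mu> k \<le> u * (1 + real k) powr (- r)"
    using mu_two_sided by metis
  have "summable (\<lambda>k. real k powr (- (r * q)))"
    using q_gt(1) by (simp add: summable_real_powr_iff mult.commute)
  then have "summable (\<lambda>k. real (Suc k) powr (- (r * q)))"
    by (subst summable_Suc_iff)
  then have s: "summable (\<lambda>k. u powr q * (1 + real k) powr (- (r * q)))"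
    by (intro summable_mult) (simp add: add.commute)
  have "\<mu> k powr q \<le> u powr q * (1 + real k) powr (- (r * q))" if "k \<ge> N" for k
  proof -
    have "\<mu> k powr q \<le> (u * (1 + real k) powr (- r)) powr q"
      using u(2)[OF that] mu(1)[of k] q_gt(2) by (intro powr_mono2) auto
    also have "\<dots> = u powr q * (1 + real k) powr (- (r * q))"
      using u(1) by (simp add: powr_mult powr_powr)
    finally show ?thesis .
  qed
  then show ?thesis
    by (intro summable_comparison_test_ev[OF _ s]) (auto simp: eventually_at_top_linorder)
qed

definition tau_bound :: "nat \<Rightarrow> real" where
  "tau_bound k = \<mu> k / (2 * theta_low) * (stat_err k)\<^sup>2 + 2 * \<zeta> k"

lemma tau_le: "tau k L d \<le> tau_bound k"
proof -
  have "theta_low \<le> theta k L d" by (simp add: theta_def)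
  then have "\<mu> k / (2 * theta k L d) * (E_err (\<mu> k) (\<zeta> k))\<^sup>2 \<le> \<mu> k / (2 * theta_low) * (stat_err k)\<^sup>2"
    using params(3) mu(1)[of k] E_err_bounds[of k]
    by (intro mult_mono divide_left_mono power_mono) auto
  then show ?thesis using zeta_Suc[of k] by (simp add: tau_def tau_bound_def)
qed

lemma tau_bound_nonneg: "0 \<le> tau_bound k"
  unfolding tau_bound_def using params(3) mu(1)[of k] zeta(1)[of k] by simp

lemma summable_tau_bound: "summable tau_bound"
proof -
  obtain A where A: "A \<ge> 0" "\<And>k. stat_err k \<le> A * (\<mu> k powr (q / 2) + \<mu> k powr (q - 1))"
    using stat_err_le by blast
  define B where "B = (\<mu> 0 + \<mu> 0 powr (q - 1)) / theta_low * A\<^sup>2 + 2 * zeta_bar"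
  have "tau_bound k \<le> B * \<mu> k powr q" for k
  proof -
    have m: "\<mu> k > 0" by (rule mu(1))
    have "(stat_err k)\<^sup>2 \<le> (A * (\<mu> k powr (q / 2) + \<mu> k powr (q - 1)))\<^sup>2"
      using A(2)[of k] E_err_bounds[of k] by (intro power_mono) auto
    also have "\<dots> = A\<^sup>2 * (\<mu> k powr (q / 2) + \<mu> k powr (q - 1))\<^sup>2" by (simp add: power_mult_distrib)
    also have "\<dots> \<le> A\<^sup>2 * (2 * (\<mu> k powr (q / 2))\<^sup>2 + 2 * (\<mu> k powr (q - 1))\<^sup>2)"
    proof (rule mult_left_mono)
      show "(a + b)\<^sup>2 \<le> 2 * a\<^sup>2 + 2 * b\<^sup>2" for a b :: real
        using zero_le_power2[of "a - b"] by (simp add: power2_eq_square algebra_simps)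
    qed simp
    also have "(\<mu> k powr (q / 2))\<^sup>2 = \<mu> k powr q" by (simp add: power2_eq_square powr_add[symmetric])
    finally have "\<mu> k / (2 * theta_low) * (stat_err k)\<^sup>2 \<le>
        \<mu> k / (2 * theta_low) * (A\<^sup>2 * (2 * \<mu> k powr q + 2 * (\<mu> k powr (q - 1))\<^sup>2))"
      using m params(3) by (intro mult_left_mono) auto
    also have "\<dots> = A\<^sup>2 / theta_low * (\<mu> k * \<mu> k powr q + \<mu> k powr (q - 1) * (\<mu> k powr (q - 1) * \<mu> k))"
      using params(3) by (simp add: field_simps power2_eq_square)
    also have "\<mu> k powr (q - 1) * \<mu> k = \<mu> k powr q" using m by (simp add: powr_diff)
    also have "A\<^sup>2 / theta_low * (\<mu> k * \<mu> k powr q + \<mu> k powr (q - 1) * \<mu> k powr q) \<le>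
        A\<^sup>2 / theta_low * (\<mu> 0 * \<mu> k powr q + \<mu> 0 powr (q - 1) * \<mu> k powr q)"
      using mu_le[of k] m q_gt(2) params(3)
      by (intro mult_left_mono add_mono mult_right_mono powr_mono2) auto
    finally show ?thesis
      using zeta_rate(3)[of k] by (simp add: tau_bound_def B_def field_simps)
  qed
  then show ?thesis
    using tau_bound_nonneg
    by (intro summable_comparison_test'[OF summable_mult[OF summable_mu_powr, of B]]) auto
qed

section \<open>Estimates along a run\<close>

definition L_bar :: real where
  "L_bar = (case rule of Fixed L \<Rightarrow> L | Doubling Lmin Lmax \<Rightarrow> max Lmax (2 * L_safe))"

lemma L_safe_pos: "L_safe > 0"
proof -
  have "0 < theta_low / theta_hat" using params by simp
  then show ?thesis unfolding L_safe_def by linarith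
qed

lemma step_choice_props:
  assumes "valid_rule" "step_choice k t w z zp L" and w: "w \<in> C" "accurate Y g \<rho> (\<zeta> k) z w"
  shows "0 < L" "L \<le> L_bar" "accept k t w z L (zp L)"
    "accurate Y g \<rho> (\<zeta> (Suc k)) (zp L) (trial k t w z L)"
proof -
  have "0 < L \<and> L \<le> L_bar \<and> accept k t w z L (zp L) \<and>
      accurate Y g \<rho> (\<zeta> (Suc k)) (zp L) (trial k t w z L)"
  proof (cases rule)
    case (Fixed L')
    then have "L = L'" "L_safe \<le> L" "accurate Y g \<rho> (\<zeta> (Suc k)) (zp L) (trial k t w z L)"
      using assms(1)[unfolded valid_rule_def] assms(2)[unfolded step_choice_def] by (auto simp: Fixed)
    moreover have "L_bar = L'" unfolding L_bar_def by (simp add: Fixed)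
    ultimately show ?thesis using accept_if_large[OF w] L_safe_pos by simp
  next
    case (Doubling Lmin Lmax)
    then obtain L0 j where L0: "0 < Lmin" "Lmin \<le> L0" "L0 \<le> Lmax" "L = 2 ^ j * L0"
      and acc: "\<And>i. i \<le> j \<Longrightarrow> accurate Y g \<rho> (\<zeta> (Suc k)) (zp (2 ^ i * L0)) (trial k t w z (2 ^ i * L0))"
      and rej: "\<And>i. i < j \<Longrightarrow> \<not> accept k t w z (2 ^ i * L0) (zp (2 ^ i * L0))"
      and "accept k t w z L (zp L)"
      using assms(1)[unfolded valid_rule_def] assms(2)[unfolded step_choice_def] by (auto simp: Doubling)
    moreover have Lb: "L_bar = max Lmax (2 * L_safe)" unfolding L_bar_def by (simp add: Doubling)
    have "L \<le> L_bar"
    proof (cases j)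
      case 0
      then show ?thesis using L0 Lb by simp
    next
      case (Suc i)
      have "2 ^ i * L0 < L_safe"
        using accept_if_large[OF w _ acc[of i]] rej[of i] Suc by fastforce
      then show ?thesis using L0(4) Suc Lb by simp
    qed
    ultimately show ?thesis using acc[of j] by simp
  qed
  then show "0 < L" "L \<le> L_bar" "accept k t w z L (zp L)"
    "accurate Y g \<rho> (\<zeta> (Suc k)) (zp L) (trial k t w z L)" by blast+
qed

definition approx_res :: "(nat \<Rightarrow> 'a \<times> 'b) \<Rightarrow> (nat \<Rightarrow> 'b) \<Rightarrow> nat \<Rightarrow> real" where
  "approx_res w z k = approx_residual g \<rho> \<delta> (z k) (w k)"

lemma run_init:
  assumes "run w z t"
  shows "valid_rule" "w 0 = w0" "accurate Y g \<rho> (\<zeta> 0) (z 0) (w 0)" "t 0 = 0"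
  using assms unfolding run_def by blast+

lemma run_iterates:
  assumes "run w z t"
  shows "w k \<in> C \<and> accurate Y g \<rho> (\<zeta> k) (z k) (w k)"
proof (induction k)
  case 0
  then show ?case using run_init[OF assms] params(6) by simp
next
  case (Suc k)
  obtain zp L where s: "step_choice k (t k) (w k) (z k) zp L"
    "w (Suc k) = trial k (t k) (w k) (z k) L" "z (Suc k) = zp L"
    using assms unfolding run_def by blast
  have "accurate Y g \<rho> (\<zeta> (Suc k)) (zp L) (trial k (t k) (w k) (z k) L)"
    using step_choice_props(4)[OF run_init(1)[OF assms] s(1)] Suc by blast
  then show ?case using s trial_in by simp
qed

lemma run_step:
  assumes "run w z t"
  obtains L where "0 < L" "L \<le> L_bar" "w (Suc k) = trial k (t k) (w k) (z k) L"
    "accept k (t k) (w k) (z k) L (z (Suc k))"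
proof -
  obtain zp L where s: "step_choice k (t k) (w k) (z k) zp L"
    "w (Suc k) = trial k (t k) (w k) (z k) L" "z (Suc k) = zp L"
    using assms unfolding run_def by blast
  have v: "valid_rule" "w k \<in> C" "accurate Y g \<rho> (\<zeta> k) (z k) (w k)"
    using run_init(1)[OF assms] run_iterates[OF assms, of k] by blast+
  show ?thesis
    using that[of L] step_choice_props[OF v(1) s(1) v(2,3)] s(2,3) by simp
qed

lemma run_update:
  assumes "run w z t"
  shows "t (Suc k) = (if approx_res w z (Suc k) > 2 * (a1 + a2) * \<mu> k \<and>
              norm (w (Suc k) - w k) \<le> c2 * \<mu> k * grid (t k)
           then t k + 1 else t k)"
proof -
  obtain zp L where "t (Suc k) =
          (if approx_residual g \<rho> \<delta> (z (Suc k)) (w (Suc k)) > 2 * (a1 + a2) * \<mu> k \<and>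
              norm (w (Suc k) - w k) \<le> c2 * \<mu> k * grid (t k)
           then t k + 1 else t k)"
    using assms unfolding run_def by blast
  then show ?thesis by (simp add: approx_res_def)
qed

lemma run_t_mono: "run w z t \<Longrightarrow> t k \<le> t (Suc k)" "run w z t \<Longrightarrow> t (Suc k) \<le> Suc (t k)"
  by (simp_all add: run_update)

definition step_const :: real where
  "step_const = L_bar + grid 0 * \<mu> 0 * L_f + L_G"

lemma run_stationarity:
  assumes "run w z t"
  obtains v where "v \<in> normal_cone C (w (Suc k))"
    "norm (grid (t k) *\<^sub>R grad f (w (Suc k)) +
        deriv (\<phi> (\<mu> k)) (approx_res w z (Suc k)) *\<^sub>R grad R (w (Suc k)) + v)
      \<le> step_const * (norm (w (Suc k) - w k) / \<mu> k) + stat_err k"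
proof -
  obtain L where L: "0 < L" "L \<le> L_bar" "w (Suc k) = trial k (t k) (w k) (z k) L"
    using run_step[OF assms] by metis
  obtain v where v: "v \<in> normal_cone C (w (Suc k))"
    "norm (grid (t k) *\<^sub>R grad f (w (Suc k)) +
        deriv (\<phi> (\<mu> k)) (approx_residual g \<rho> \<delta> (z (Suc k)) (w (Suc k))) *\<^sub>R grad R (w (Suc k)) + v)
      \<le> (L + grid 0 * \<mu> 0 * L_f + L_G) * (norm (w (Suc k) - w k) / \<mu> k) + stat_err k"
    using step_stationarity[OF _ _ L(1,3)] run_iterates[OF assms] by metis
  have "(L + grid 0 * \<mu> 0 * L_f + L_G) * (norm (w (Suc k) - w k) / \<mu> k) \<le>
      step_const * (norm (w (Suc k) - w k) / \<mu> k)"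
    unfolding step_const_def using L(2) mu(1)[of k] by (intro mult_right_mono) auto
  then show ?thesis using that[OF v(1)] v(2) by (simp add: approx_res_def)
qed

text \<open>The energy is the penalized objective, shifted by \<open>c_phi * \<mu> k\<close> to absorb the change of the
  smoothing parameter.\<close>

lemma energy_bound:
  obtains M where "M \<ge> 0"
    "\<And>w z t n. run w z t \<Longrightarrow> (\<Sum>k<n. (norm (w (Suc k) - w k))\<^sup>2 / \<mu> k) \<le> M"
proof -
  have c: "0 \<le> c_phi" "0 \<le> a1" using smoothing(1) by (simp_all add: smoothing_def)
  obtain x where x: "x \<in> C" "\<And>v. v \<in> C \<Longrightarrow> f x \<le> f v"
    using continuous_attains_inf[OF compact_C _ gderiv_continuous_on[OF f_gderiv]] params(6) by blast
  define T where "T = suminf tau_bound"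
  define V0 where "V0 = grid 0 * (f w0 - f x) + \<phi> (\<mu> 0) (R w0) + c_phi * \<mu> 0"
  define M where "M = 2 / c1 * (V0 + a1 * \<mu> 0 + T)"
  have bound: "(\<Sum>k<n. (norm (w (Suc k) - w k))\<^sup>2 / \<mu> k) \<le> M" if run: "run w z t" for w z t n
  proof -
    define V where "V k = grid (t k) * (f (w k) - f x) + \<phi> (\<mu> k) (approx_res w z k) + c_phi * \<mu> k" for k
    have step: "V (Suc k) + c1 / 2 * ((norm (w (Suc k) - w k))\<^sup>2 / \<mu> k) \<le> V k + tau_bound k" for k
    proof -
      obtain L where L: "w (Suc k) = trial k (t k) (w k) (z k) L" "accept k (t k) (w k) (z k) L (z (Suc k))"
        using run_step[OF run] by metis
      have "grid (t k) * f (w (Suc k)) + \<phi> (\<mu> k) (approx_res w z (Suc k) + \<zeta> (Suc k))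
         \<le> grid (t k) * f (w k) + \<phi> (\<mu> k) (approx_res w z k)
          - c1 / (2 * \<mu> k) * (norm (w (Suc k) - w k))\<^sup>2 + tau k L (norm (w (Suc k) - w k))"
        using L(2) unfolding accept_def Let_def L(1)[symmetric] approx_res_def by simp
      moreover have "\<phi> (\<mu> k) (approx_res w z (Suc k)) \<le> \<phi> (\<mu> k) (approx_res w z (Suc k) + \<zeta> (Suc k))"
        using zeta(1)[of "Suc k"] by (intro smoothing_mono[OF smoothing(1) mu(1)]) simp
      moreover have "\<phi> (\<mu> (Suc k)) (approx_res w z (Suc k))
          \<le> \<phi> (\<mu> k) (approx_res w z (Suc k)) + c_phi * (\<mu> k - \<mu> (Suc k))"
        using smoothing(1) mu(1) mu(2) by (simp add: smoothing_def decseq_Suc_iff)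
      moreover have "grid (t (Suc k)) * (f (w (Suc k)) - f x) \<le> grid (t k) * (f (w (Suc k)) - f x)"
        using x(2) run_iterates[OF run] grid(2) run_t_mono(1)[OF run]
        by (intro mult_right_mono) (auto simp: decseq_def)
      ultimately show ?thesis
        using tau_le[of k L "norm (w (Suc k) - w k)"] unfolding V_def
        by (simp add: algebra_simps)
    qed
    have "V n + c1 / 2 * (\<Sum>k<n. (norm (w (Suc k) - w k))\<^sup>2 / \<mu> k) \<le> V 0 + (\<Sum>k<n. tau_bound k)"
    proof (induction n)
      case (Suc n)
      then show ?case using step[of n] by (simp add: distrib_left)
    qed simp
    moreover have "(\<Sum>k<n. tau_bound k) \<le> T"
      unfolding T_def using tau_bound_nonneg by (intro sum_le_suminf summable_tau_bound) auto
    moreover have "V 0 \<le> V0"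
    proof -
      have "approx_res w z 0 \<le> R w0"
        using accurate_residual(1)[OF run_init(3)[OF run]] by (simp add: approx_res_def run_init(2)[OF run])
      then show ?thesis
        using smoothing_mono[OF smoothing(1) mu(1)] by (simp add: V_def V0_def run_init[OF run])
    qed
    moreover have "- a1 * \<mu> 0 \<le> V n"
    proof -
      have "max (approx_res w z n) 0 - a1 * \<mu> n \<le> \<phi> (\<mu> n) (approx_res w z n)"
        by (rule smoothing_bounds[OF smoothing(1) mu(1)])
      moreover have "a1 * \<mu> n \<le> a1 * \<mu> 0" using mu_le c(2) by (rule mult_left_mono)
      moreover have "0 \<le> grid (t n) * (f (w n) - f x)" "0 \<le> c_phi * \<mu> n"
        using grid(1)[of "t n"] x(2) run_iterates[OF run] c(1) mu(1)[of n] by simp_all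
      ultimately show ?thesis unfolding V_def by linarith
    qed
    ultimately have "c1 / 2 * (\<Sum>k<n. (norm (w (Suc k) - w k))\<^sup>2 / \<mu> k) \<le> V0 + a1 * \<mu> 0 + T"
      by linarith
    then show ?thesis unfolding M_def using params(1) by (simp add: field_simps)
  qed
  show ?thesis
  proof (rule that[of "max M 0"])
    show "(\<Sum>k<n. (norm (w (Suc k) - w k))\<^sup>2 / \<mu> k) \<le> max M 0" if "run w z t" for w z t n
      using bound[OF that, of n] by simp
  qed simp
qed

text \<open>At a penalty update the multiplier \<open>\<phi>' \<ge> 1/2\<close> would make the point nearly stationary for
  \<open>R\<close> once \<open>grid (t k)\<close> and \<open>stat_err k\<close> are small, which the constraint qualification forbids.\<close>

lemma updates_bounded:
  obtains T where "\<And>w z t k. run w z t \<Longrightarrow> t k \<le> T"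
proof -
  have "continuous_on C R" using R_gderiv_grad by (rule gderiv_continuous_on)
  moreover have "continuous_on C (grad R)" using L_R by (rule lipschitz_on_continuous_on)
  ultimately obtain \<kappa> where \<kappa>: "\<kappa> > 0"
    "\<And>w v. w \<in> C \<Longrightarrow> R w \<ge> 0 \<Longrightarrow> v \<in> normal_cone C w \<Longrightarrow> \<kappa> \<le> norm (grad R w + v)"
    using ENNAMCQ_uniform[OF compact_C _ _ ennamcq] by metis
  have "bounded (grad f ` C)"
    by (intro compact_imp_bounded compact_continuous_image compact_C lipschitz_on_continuous_on[OF f(2)])
  then obtain Bf where Bf: "Bf > 0" "\<And>w. w \<in> C \<Longrightarrow> norm (grad f w) \<le> Bf"
    unfolding bounded_pos by auto
  define S where "S = \<bar>step_const\<bar> * c2 + Bf"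
  have "(\<lambda>n. 2 * grid n * S) \<longlonglongrightarrow> 2 * 0 * S" by (intro tendsto_intros grid(3))
  from order_tendstoD(2)[OF this, of "\<kappa> / 2"] \<kappa>(1)
  have "eventually (\<lambda>n. 2 * grid n * S < \<kappa> / 2) sequentially" by simp
  then obtain T1 where T1: "\<And>n. n \<ge> T1 \<Longrightarrow> 2 * grid n * S < \<kappa> / 2"
    unfolding eventually_at_top_linorder by blast
  have "(\<lambda>n. 2 * stat_err n) \<longlonglongrightarrow> 2 * 0" by (intro tendsto_intros stat_err_tendsto)
  from order_tendstoD(2)[OF this, of "\<kappa> / 2"] \<kappa>(1)
  have "eventually (\<lambda>n. 2 * stat_err n < \<kappa> / 2) sequentially" by simp
  then obtain k1 where k1: "\<And>n. n \<ge> k1 \<Longrightarrow> 2 * stat_err n < \<kappa> / 2"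
    unfolding eventually_at_top_linorder by blast
  have upd: "t k < T1" if run: "run w z t" and k: "k \<ge> k1" and ne: "t (Suc k) \<noteq> t k" for w z t k
  proof (rule ccontr)
    assume "\<not> t k < T1"
    then have T1': "2 * grid (t k) * S < \<kappa> / 2" by (intro T1) simp
    define wp where "wp = w (Suc k)"
    define p where "p = deriv (\<phi> (\<mu> k)) (approx_res w z (Suc k))"
    define G where "G = grid (t k)"
    have G: "G > 0" using grid(1) by (simp add: G_def)
    have u: "approx_res w z (Suc k) > 2 * (a1 + a2) * \<mu> k" "norm (w (Suc k) - w k) \<le> c2 * \<mu> k * G"
      using ne run_update[OF run, of k] by (auto simp: G_def split: if_splits)
    have p: "p \<ge> 1 / 2" unfolding p_def by (rule smoothing_deriv_ge_half[OF smoothing(1) mu(1) u(1)])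
    have wp: "wp \<in> C" using run_iterates[OF run] by (simp add: wp_def)
    have "0 < 2 * (a1 + a2) * \<mu> k" using smoothing(2) mu(1) by simp
    then have "R wp \<ge> 0"
      using u(1) accurate_residual(1) run_iterates[OF run, of "Suc k"]
      unfolding approx_res_def wp_def by fastforce
    obtain v where v: "v \<in> normal_cone C wp"
      "norm (G *\<^sub>R grad f wp + p *\<^sub>R grad R wp + v) \<le> step_const * (norm (w (Suc k) - w k) / \<mu> k) + stat_err k"
      using run_stationarity[OF run] unfolding wp_def p_def G_def by metis
    have "(1 / p) *\<^sub>R v \<in> normal_cone C wp" using v(1) p by (intro normal_cone_scale) auto
    then have "\<kappa> \<le> norm (grad R wp + (1 / p) *\<^sub>R v)" by (rule \<kappa>(2)[OF wp \<open>R wp \<ge> 0\<close>])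
    then have "p * \<kappa> \<le> p * norm (grad R wp + (1 / p) *\<^sub>R v)" using p by (intro mult_left_mono) auto
    also have "\<dots> = norm (p *\<^sub>R (grad R wp + (1 / p) *\<^sub>R v))" using p by simp
    also have "p *\<^sub>R (grad R wp + (1 / p) *\<^sub>R v) = (G *\<^sub>R grad f wp + p *\<^sub>R grad R wp + v) - G *\<^sub>R grad f wp"
      using p by (simp add: scaleR_add_right)
    also have "norm \<dots> \<le> norm (G *\<^sub>R grad f wp + p *\<^sub>R grad R wp + v) + norm (G *\<^sub>R grad f wp)"
      by (rule norm_triangle_ineq4)
    finally have 1: "p * \<kappa> \<le> norm (G *\<^sub>R grad f wp + p *\<^sub>R grad R wp + v) + norm (G *\<^sub>R grad f wp)" .
    have 2: "norm (G *\<^sub>R grad f wp) \<le> G * Bf" using Bf(2)[OF wp] G by simp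
    have "norm (w (Suc k) - w k) / \<mu> k \<le> c2 * G"
      using u(2) mu(1)[of k] by (simp add: pos_divide_le_eq mult_ac)
    then have "step_const * (norm (w (Suc k) - w k) / \<mu> k) \<le> \<bar>step_const\<bar> * (c2 * G)"
      using mu(1)[of k] by (intro mult_mono) auto
    then have "p * \<kappa> \<le> G * S + stat_err k"
      using 1 2 v(2) unfolding S_def by (simp add: algebra_simps)
    moreover have "1 / 2 * \<kappa> \<le> p * \<kappa>" using p \<kappa>(1) by (intro mult_right_mono) auto
    ultimately show False using T1' k1[OF k] unfolding G_def by simp
  qed
  show ?thesis
  proof (rule that[of "max T1 k1"])
    fix w z t k assume run: "run w z t"
    have le: "t j \<le> j" for j
    proof (induction j)
      case (Suc j)
      then show ?case using run_t_mono(2)[OF run, of j] by simp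
    qed (simp add: run_init(4)[OF run])
    show "t k \<le> max T1 k1"
    proof (induction k)
      case (Suc k)
      show ?case
      proof (cases "k \<ge> k1 \<and> t (Suc k) \<noteq> t k")
        case True
        then have "t k < T1" using upd[OF run] by blast
        then show ?thesis using run_t_mono(2)[OF run, of k] by simp
      next
        case False
        then show ?thesis using Suc le[of "Suc k"] by (cases "k \<ge> k1") auto
      qed
    qed (simp add: run_init(4)[OF run])
  qed
qed

end

section \<open>Convergence rate\<close>

lemma powr_rate_le:
  fixes M e a x :: real
  assumes "0 \<le> M" "0 < e" "0 < a" "0 < x" "M powr (1 / a) * e powr (- 1 / a) \<le> x"
  shows "M * x powr (- a) \<le> e"
proof (cases "M = 0")
  case False
  then have M: "M > 0" using assms(1) by simp
  have "(M powr (1 / a) * e powr (- 1 / a)) powr a \<le> x powr a"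
    using assms by (intro powr_mono2) auto
  moreover have "(M powr (1 / a) * e powr (- 1 / a)) powr a = M / e"
    using assms M by (simp add: powr_mult powr_divide powr_powr powr_minus_divide)
  ultimately have "M \<le> e * x powr a" using assms by (simp add: pos_divide_le_eq mult.commute)
  then show ?thesis using assms by (simp add: powr_minus_divide pos_divide_le_eq)
qed (use assms in simp)

context ivsp_setting
begin

lemma good_index:
  assumes run: "run w z t" and T: "\<And>k. t k \<le> T"
    and M: "\<And>n. (\<Sum>k<n. (norm (w (Suc k) - w k))\<^sup>2 / \<mu> k) \<le> M"
    and K: "2 * (M + real T) < real K" "1 \<le> K"
  obtains k where "K \<le> 2 * k" "k \<le> K" "t (Suc k) = t k"
    "(norm (w (Suc k) - w k))\<^sup>2 / \<mu> k \<le> 2 * (M + real T) / real K"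
proof -
  define e where "e k = (norm (w (Suc k) - w k))\<^sup>2 / \<mu> k + (real (t (Suc k)) - real (t k))" for k
  define c where "c = 2 * (M + real T) / real K"
  have parts: "0 \<le> (norm (w (Suc k) - w k))\<^sup>2 / \<mu> k" "0 \<le> real (t (Suc k)) - real (t k)" for k
    using mu(1)[of k] run_t_mono(1)[OF run, of k] by simp_all
  have M0: "0 \<le> M" using M[of 0] by simp
  have "\<exists>k\<in>{(K + 1) div 2..K}. e k \<le> c"
  proof (rule ccontr)
    assume "\<not> ?thesis"
    then have gt: "c < e k" if "k \<in> {(K + 1) div 2..K}" for k using that by force
    have "M + real T = real K / 2 * c" using K(2) by (simp add: c_def)
    also have "\<dots> \<le> real (card {(K + 1) div 2..K}) * c"
      using M0 by (intro mult_right_mono) (auto simp: c_def field_simps)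
    also have "\<dots> = (\<Sum>k\<in>{(K + 1) div 2..K}. c)" by simp
    also have "\<dots> < (\<Sum>k\<in>{(K + 1) div 2..K}. e k)"
      using gt by (intro sum_strict_mono) auto
    also have "\<dots> \<le> (\<Sum>k<Suc K. e k)"
      using parts by (intro sum_mono2) (auto simp: e_def add_nonneg_nonneg)
    also have "\<dots> = (\<Sum>k<Suc K. (norm (w (Suc k) - w k))\<^sup>2 / \<mu> k) + (real (t (Suc K)) - real (t 0))"
      unfolding e_def sum.distrib by (simp only: sum_lessThan_telescope[of "\<lambda>k. real (t k)"])
    also have "\<dots> \<le> M + real T" using M[of "Suc K"] T[of "Suc K"] by linarith
    finally show False by simp
  qed
  then obtain k where k: "(K + 1) div 2 \<le> k" "k \<le> K" "e k \<le> c" by auto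
  have "c < 1" using K by (simp add: c_def)
  then have "real (t (Suc k)) - real (t k) < 1" using k(3) parts[of k] unfolding e_def by linarith
  then have "t (Suc k) = t k" using run_t_mono(1)[OF run, of k] by linarith
  moreover have "(norm (w (Suc k) - w k))\<^sup>2 / \<mu> k \<le> c" using k(3) parts[of k] unfolding e_def by linarith
  moreover have "K \<le> 2 * k" using k(1) by linarith
  ultimately show ?thesis using that k(2) unfolding c_def by blast
qed

text \<open>At an index without penalty update and with a short step, the update test can only have failed
  because the residual is small.\<close>

lemma kkt_at_index:
  assumes run: "run w z t" and g0: "0 < g0" "g0 \<le> grid (t k)"
    and no: "t (Suc k) = t k" and short: "norm (w (Suc k) - w k) / \<mu> k \<le> c2 * g0"
  defines "l \<equiv> multiplier w z t k" and "Mf \<equiv> 2 * (a1 + a2) + zeta_bar * \<mu> 0 powr (q - 1)"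
  shows "0 \<le> l"
    "stat_residual C f R (w (Suc k)) l \<le>
      (\<bar>step_const\<bar> * (norm (w (Suc k) - w k) / \<mu> k) + stat_err k) / g0"
    "feas_residual R (w (Suc k)) \<le> Mf * \<mu> k"
    "comp_residual R (w (Suc k)) l \<le> Mf / g0 * \<mu> k"
proof -
  define wp where "wp = w (Suc k)"
  define G where "G = grid (t k)"
  define s where "s = approx_res w z (Suc k)"
  define p where "p = deriv (\<phi> (\<mu> k)) s"
  define D where "D = norm (w (Suc k) - w k) / \<mu> k"
  have G: "0 < G" "g0 \<le> G" using grid(1) g0 by (simp_all add: G_def)
  have m: "0 < \<mu> k" "\<mu> k \<le> \<mu> 0" using mu(1) mu_le by simp_all
  have a: "0 \<le> a1" "0 \<le> a2" using smoothing(1) by (simp_all add: smoothing_def)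
  have D0: "0 \<le> D" unfolding D_def using m by simp
  have p: "0 \<le> p" "p \<le> 1" unfolding p_def by (rule smoothing_deriv_bounds[OF smoothing(1) m(1)])+
  have l: "l = p / G" by (simp add: l_def multiplier_def p_def s_def G_def approx_res_def field_simps)
  show l0: "0 \<le> l" using l p G by simp
  obtain v where v: "v \<in> normal_cone C wp"
      "norm (G *\<^sub>R grad f wp + p *\<^sub>R grad R wp + v) \<le> step_const * D + stat_err k"
    using run_stationarity[OF run, of k] unfolding wp_def p_def s_def G_def D_def by metis
  have "(1 / G) *\<^sub>R v \<in> normal_cone C wp" using v(1) G by (intro normal_cone_scale) auto
  then have "stat_residual C f R wp l \<le> norm (grad f wp + l *\<^sub>R grad R wp + (1 / G) *\<^sub>R v)"
    by (rule stat_residual_le)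
  also have "grad f wp + l *\<^sub>R grad R wp + (1 / G) *\<^sub>R v = (1 / G) *\<^sub>R (G *\<^sub>R grad f wp + p *\<^sub>R grad R wp + v)"
    using G by (simp add: l scaleR_add_right)
  also have "norm \<dots> = norm (G *\<^sub>R grad f wp + p *\<^sub>R grad R wp + v) / G" using G by simp
  also have "\<dots> \<le> (\<bar>step_const\<bar> * D + stat_err k) / G"
    using v(2) G D0 mult_right_mono[OF abs_ge_self[of step_const] D0]
    by (intro divide_right_mono) linarith+
  also have "\<dots> \<le> (\<bar>step_const\<bar> * D + stat_err k) / g0"
    using G g0 D0 stat_err_nonneg[of k] by (intro divide_left_mono) auto
  finally show "stat_residual C f R (w (Suc k)) l \<le>
      (\<bar>step_const\<bar> * (norm (w (Suc k) - w k) / \<mu> k) + stat_err k) / g0"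
    unfolding wp_def D_def .
  have acc: "accurate Y g \<rho> (\<zeta> (Suc k)) (z (Suc k)) wp"
    using run_iterates[OF run, of "Suc k"] by (simp add: wp_def)
  have R: "s \<le> R wp" "R wp \<le> s + \<zeta> k"
    using accurate_residual[OF acc] zeta_Suc[of k] by (simp_all add: s_def approx_res_def wp_def)
  have "norm (w (Suc k) - w k) \<le> c2 * g0 * \<mu> k" using short m by (simp add: pos_divide_le_eq)
  also have "\<dots> \<le> c2 * \<mu> k * grid (t k)"
    using g0 params(2) m mult_left_mono[OF g0(2), of "c2 * \<mu> k"] by (simp add: mult_ac)
  finally have "s \<le> 2 * (a1 + a2) * \<mu> k"
    using no run_update[OF run, of k] unfolding s_def by (auto split: if_splits)
  moreover have "\<zeta> k \<le> zeta_bar * \<mu> 0 powr (q - 1) * \<mu> k"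
  proof -
    have "\<mu> k powr (q - 1) \<le> \<mu> 0 powr (q - 1)" using m q_gt(2) by (intro powr_mono2) auto
    then have "zeta_bar * \<mu> k powr (q - 1) * \<mu> k \<le> zeta_bar * \<mu> 0 powr (q - 1) * \<mu> k"
      using zeta_rate(1) m by (intro mult_right_mono mult_left_mono) auto
    then show ?thesis using zeta_le_mu[of k] by linarith
  qed
  ultimately have Rf: "R wp \<le> Mf * \<mu> k" using R(2) unfolding Mf_def by (simp add: algebra_simps)
  have Mf: "a1 + a2 \<le> Mf" using a zeta_rate(1) by (simp add: Mf_def)
  have Mf0: "0 \<le> Mf * \<mu> k" using Mf a m by (intro mult_nonneg_nonneg) auto
  show "feas_residual R (w (Suc k)) \<le> Mf * \<mu> k"
    using Rf Mf0 by (simp add: feas_residual_def wp_def)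
  have "p * \<bar>R wp\<bar> \<le> Mf * \<mu> k"
  proof (cases "0 \<le> R wp")
    case True
    have "p * \<bar>R wp\<bar> \<le> 1 * \<bar>R wp\<bar>" using p by (intro mult_right_mono) auto
    then show ?thesis using Rf True by simp
  next
    case False
    have "p * \<bar>R wp\<bar> \<le> p * \<bar>s\<bar>" using False R(1) p by (intro mult_left_mono) auto
    also have "\<dots> \<le> (a1 + a2) * \<mu> k"
      unfolding p_def using False R(1) by (intro smoothing_deriv_mult_le[OF smoothing(1) m(1)]) simp
    also have "\<dots> \<le> Mf * \<mu> k" using Mf m by (intro mult_right_mono) auto
    finally show ?thesis .
  qed
  then have "p * \<bar>R wp\<bar> / G \<le> Mf * \<mu> k / G" using G by (intro divide_right_mono) auto
  also have "\<dots> \<le> Mf * \<mu> k / g0" using G g0 Mf0 by (intro divide_left_mono) auto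
  finally show "comp_residual R (w (Suc k)) l \<le> Mf / g0 * \<mu> k"
    using p G by (simp add: comp_residual_def l abs_mult wp_def)
qed

lemma mu_rate_index:
  assumes "0 < l" "0 < u" "l * (1 + real k) powr (- r) \<le> \<mu> k" "\<mu> k \<le> u * (1 + real k) powr (- r)"
    and "K \<le> 2 * k" "k \<le> K" "1 \<le> K"
  shows "l * 2 powr (- r) * real K powr (- r) \<le> \<mu> k" "\<mu> k \<le> u * 2 powr r * real K powr (- r)"
proof -
  have "(2 * real K) powr (- r) \<le> (1 + real k) powr (- r)"
    using assms mu_rate(1) by (intro powr_mono2') auto
  then have "l * (2 * real K) powr (- r) \<le> l * (1 + real k) powr (- r)"
    using assms(1) by (intro mult_left_mono) auto
  then show "l * 2 powr (- r) * real K powr (- r) \<le> \<mu> k"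
    using assms(3) by (simp add: powr_mult mult.assoc)
  have "(1 + real k) powr (- r) \<le> (real K / 2) powr (- r)"
    using assms mu_rate(1) by (intro powr_mono2') auto
  also have "\<dots> = 2 powr r * real K powr (- r)"
    by (simp add: powr_divide powr_minus_divide)
  finally have "u * (1 + real k) powr (- r) \<le> u * (2 powr r * real K powr (- r))"
    using assms(2) by (intro mult_left_mono) auto
  then show "\<mu> k \<le> u * 2 powr r * real K powr (- r)"
    using assms(4) by (simp only: mult.assoc)
qed

lemma rate:
  obtains Ms Mf Mc K0 where "0 \<le> Ms" "0 \<le> Mf" "0 \<le> Mc"
    "\<And>w z t K. run w z t \<Longrightarrow> K \<ge> K0 \<Longrightarrow> 1 \<le> K \<and> (\<exists>k. K \<le> 2 * k \<and> k \<le> K \<and> 0 \<le> multiplier w z t k \<and>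
      stat_residual C f R (w (Suc k)) (multiplier w z t k) \<le> Ms * real K powr (- ((1 - r) / 2)) \<and>
      feas_residual R (w (Suc k)) \<le> Mf * real K powr (- r) \<and>
      comp_residual R (w (Suc k)) (multiplier w z t k) \<le> Mc * real K powr (- r))"
proof -
  obtain T where T: "\<And>w z t k. run w z t \<Longrightarrow> t k \<le> T" using updates_bounded by blast
  obtain M where M: "M \<ge> 0" "\<And>w z t n. run w z t \<Longrightarrow> (\<Sum>k<n. (norm (w (Suc k) - w k))\<^sup>2 / \<mu> k) \<le> M"
    using energy_bound by blast
  obtain l u N where lu: "l > 0" "u > 0"
    "\<And>k. k \<ge> N \<Longrightarrow> l * (1 + real k) powr (- r) \<le> \<mu> k"
    "\<And>k. k \<ge> N \<Longrightarrow> \<mu> k \<le> u * (1 + real k) powr (- r)" using mu_two_sided by metis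
  obtain A where A: "A \<ge> 0" "\<And>k. stat_err k \<le> A * (\<mu> k powr (q / 2) + \<mu> k powr (q - 1))"
    using stat_err_le by blast
  define g0 where "g0 = grid T"
  define U where "U = u * 2 powr r"
  define l' where "l' = l * 2 powr (- r)"
  define M' where "M' = M + real T"
  define cd where "cd = sqrt (2 * M' / l')"
  define a where "a = (1 - r) / 2"
  define As where "As = A * (U powr (q / 2) + U powr (q - 1))"
  define Mf where "Mf = 2 * (a1 + a2) + zeta_bar * \<mu> 0 powr (q - 1)"
  have g0: "g0 > 0" using grid(1) by (simp add: g0_def)
  have pos: "0 < U" "0 < l'" "0 \<le> M'" "0 \<le> cd" "0 < a" "0 \<le> As" "0 \<le> Mf"
    unfolding U_def l'_def M'_def cd_def a_def As_def Mf_def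
    using lu M(1) mu_rate A(1) smoothing(2) zeta_rate(1) by simp_all
  have "(\<lambda>K. cd * real K powr (- a)) \<longlonglongrightarrow> cd * 0"
    using pos by (intro tendsto_intros tendsto_neg_powr filterlim_real_sequentially) auto
  from order_tendstoD(2)[OF this, of "c2 * g0"] g0 params(2)
  have "eventually (\<lambda>K. cd * real K powr (- a) < c2 * g0) sequentially" by simp
  then obtain K1 where K1: "\<And>K. K \<ge> K1 \<Longrightarrow> cd * real K powr (- a) < c2 * g0"
    unfolding eventually_at_top_linorder by blast
  obtain K2 :: nat where K2: "2 * M' < real K2" using reals_Archimedean2 by blast
  define K0 where "K0 = max (max K1 K2) (max (2 * N) 1)"
  have main: "1 \<le> K \<and> (\<exists>k. K \<le> 2 * k \<and> k \<le> K \<and> 0 \<le> multiplier w z t k \<and>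
      stat_residual C f R (w (Suc k)) (multiplier w z t k) \<le> (\<bar>step_const\<bar> * cd + As) / g0 * real K powr (- a) \<and>
      feas_residual R (w (Suc k)) \<le> Mf * U * real K powr (- r) \<and>
      comp_residual R (w (Suc k)) (multiplier w z t k) \<le> Mf / g0 * U * real K powr (- r))"
    if run: "run w z t" and K: "K \<ge> K0" for w z t K
  proof
    show K1': "1 \<le> K" using K by (simp add: K0_def)
    then have x: "1 \<le> real K" by simp
    have "2 * M' < real K" using K K2 by (simp add: K0_def)
    then obtain k where k: "K \<le> 2 * k" "k \<le> K" "t (Suc k) = t k"
      "(norm (w (Suc k) - w k))\<^sup>2 / \<mu> k \<le> 2 * M' / real K"
      using good_index[OF run T[OF run] M(2)[OF run] _ K1'] unfolding M'_def by metis
    have kN: "k \<ge> N" using k(1) K by (simp add: K0_def)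
    have mu_k: "l' * real K powr (- r) \<le> \<mu> k" "\<mu> k \<le> U * real K powr (- r)"
      using mu_rate_index[OF lu(1,2) lu(3,4)[OF kN] k(1,2) K1'] by (simp_all add: l'_def U_def)
    have m: "\<mu> k > 0" by (rule mu(1))
    define d where "d = norm (w (Suc k) - w k)"
    have "d / \<mu> k \<le> cd * real K powr (- a)"
    proof (rule power2_le_imp_le)
      have "(d / \<mu> k)\<^sup>2 = d\<^sup>2 / \<mu> k / \<mu> k" by (simp add: power_divide power2_eq_square)
      also have "\<dots> \<le> (2 * M' / real K) / (l' * real K powr (- r))"
        by (rule frac_le) (use k(4) mu_k(1) pos x m in \<open>auto simp: d_def\<close>)
      also have "\<dots> = 2 * M' / l' * (real K powr r / real K)"
        by (simp add: powr_minus_divide)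
      also have "real K powr r / real K = real K powr (- a) * real K powr (- a)"
        using x by (simp add: a_def powr_add[symmetric] powr_diff)
      also have "2 * M' / l' = cd\<^sup>2" using pos by (simp add: cd_def)
      finally show "(d / \<mu> k)\<^sup>2 \<le> (cd * real K powr (- a))\<^sup>2"
        by (simp add: power2_eq_square mult_ac)
    qed (use pos in simp)
    note D = this
    have short: "d / \<mu> k \<le> c2 * g0" using D K1[of K] K by (simp add: K0_def)
    have grid_t: "g0 \<le> grid (t k)" unfolding g0_def using T[OF run] grid(2) by (simp add: decseq_def)
    have pw: "\<mu> k powr b \<le> U powr b * real K powr (- a)" if "0 < b" "a \<le> r * b" for b
    proof -
      have "\<mu> k powr b \<le> (U * real K powr (- r)) powr b" using mu_k(2) m that(1) by (intro powr_mono2) auto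
      also have "\<dots> = U powr b * real K powr (- (r * b))" using pos by (simp add: powr_mult powr_powr)
      also have "\<dots> \<le> U powr b * real K powr (- a)"
        using x that(2) by (intro mult_left_mono powr_mono) auto
      finally show ?thesis .
    qed
    have "stat_err k \<le> A * (U powr (q / 2) * real K powr (- a) + U powr (q - 1) * real K powr (- a))"
      using A q_gt mu_rate by (intro order_trans[OF A(2)] mult_left_mono add_mono pw)
        (auto simp: a_def field_simps)
    then have err: "stat_err k \<le> As * real K powr (- a)" by (simp add: As_def algebra_simps)
    have kkt: "0 \<le> multiplier w z t k"
      "stat_residual C f R (w (Suc k)) (multiplier w z t k) \<le> (\<bar>step_const\<bar> * (d / \<mu> k) + stat_err k) / g0"
      "feas_residual R (w (Suc k)) \<le> Mf * \<mu> k"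
      "comp_residual R (w (Suc k)) (multiplier w z t k) \<le> Mf / g0 * \<mu> k"
      using kkt_at_index[OF run g0 grid_t k(3)] short unfolding d_def Mf_def by blast+
    have "\<bar>step_const\<bar> * (d / \<mu> k) + stat_err k \<le> \<bar>step_const\<bar> * (cd * real K powr (- a)) + As * real K powr (- a)"
      using D err by (intro add_mono mult_left_mono) auto
    then have "(\<bar>step_const\<bar> * (d / \<mu> k) + stat_err k) / g0 \<le>
        (\<bar>step_const\<bar> * (cd * real K powr (- a)) + As * real K powr (- a)) / g0"
      using g0 by (intro divide_right_mono) auto
    also have "\<dots> = (\<bar>step_const\<bar> * cd + As) / g0 * real K powr (- a)" by (simp add: algebra_simps)
    finally have 1: "stat_residual C f R (w (Suc k)) (multiplier w z t k) \<le>
        (\<bar>step_const\<bar> * cd + As) / g0 * real K powr (- a)" using kkt(2) by linarith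
    have 2: "feas_residual R (w (Suc k)) \<le> Mf * U * real K powr (- r)"
      using kkt(3) mult_left_mono[OF mu_k(2) pos(7)] by (simp add: mult.assoc)
    have 3: "comp_residual R (w (Suc k)) (multiplier w z t k) \<le> Mf / g0 * U * real K powr (- r)"
      using kkt(4) mult_left_mono[OF mu_k(2), of "Mf / g0"] pos g0 by (simp add: mult.assoc)
    show "\<exists>k. K \<le> 2 * k \<and> k \<le> K \<and> 0 \<le> multiplier w z t k \<and>
      stat_residual C f R (w (Suc k)) (multiplier w z t k) \<le> (\<bar>step_const\<bar> * cd + As) / g0 * real K powr (- a) \<and>
      feas_residual R (w (Suc k)) \<le> Mf * U * real K powr (- r) \<and>
      comp_residual R (w (Suc k)) (multiplier w z t k) \<le> Mf / g0 * U * real K powr (- r)"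
      using k(1,2) kkt(1) 1 2 3 by blast
  qed
  show ?thesis
  proof (rule that)
    show "0 \<le> (\<bar>step_const\<bar> * cd + As) / g0" "0 \<le> Mf * U" "0 \<le> Mf / g0 * U"
      using pos g0 by simp_all
  qed (use main in \<open>simp add: a_def\<close>)
qed

lemma complexity:
  assumes K0: "1 \<le> K0" and Ms: "0 \<le> Ms" "0 \<le> Mf" "0 \<le> Mc"
    and tol: "0 < es" "es \<le> 1" "0 < ef" "ef \<le> 1" "0 < ec" "ec \<le> 1"
    and wC: "\<And>j. w j \<in> C"
    and rate: "\<And>K. K \<ge> K0 \<Longrightarrow> \<exists>k. k \<le> K \<and> 0 \<le> l k \<and>
      stat_residual C f R (w (Suc k)) (l k) \<le> Ms * real K powr (- ((1 - r) / 2)) \<and>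
      feas_residual R (w (Suc k)) \<le> Mf * real K powr (- r) \<and>
      comp_residual R (w (Suc k)) (l k) \<le> Mc * real K powr (- r)"
  defines "B \<equiv> real K0 + Ms powr (2 / (1 - r)) + Mf powr (1 / r) + Mc powr (1 / r)"
  shows "\<exists>j. real j \<le> (B + 2) * max (es powr (- 2 / (1 - r))) (max (ef powr (- 1 / r)) (ec powr (- 1 / r)))
    \<and> KKT_point C f R es ef ec (w j)"
proof -
  define a where "a = (1 - r) / 2"
  have a: "0 < a" "1 / a = 2 / (1 - r)" "- 1 / a = - 2 / (1 - r)" using mu_rate by (auto simp: a_def)
  define H where "H = max (es powr (- 1 / a)) (max (ef powr (- 1 / r)) (ec powr (- 1 / r)))"
  have ge1: "1 \<le> es powr (- 1 / a)"
    using tol a(1) powr_mono2[of "1 / a" es 1]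
    by (simp add: powr_minus_divide)
  have H: "1 \<le> H" "es powr (- 1 / a) \<le> H" "ef powr (- 1 / r) \<le> H" "ec powr (- 1 / r) \<le> H"
    using ge1 by (auto simp: H_def)
  have B: "0 \<le> B" "real K0 \<le> B" "Ms powr (1 / a) \<le> B" "Mf powr (1 / r) \<le> B" "Mc powr (1 / r) \<le> B"
    using K0 by (simp_all add: B_def a(2))
  define K where "K = nat \<lceil>B * H\<rceil>"
  have BH: "0 \<le> B * H" using B H by simp
  have KB: "B * H \<le> real K" "real K \<le> B * H + 1" unfolding K_def using BH by linarith+
  have "B * 1 \<le> B * H" using B H by (intro mult_left_mono) auto
  then have K: "K0 \<le> K" "0 < real K" using B(2) KB(1) K0 by linarith+
  obtain k where k: "k \<le> K" "0 \<le> l k"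
      "stat_residual C f R (w (Suc k)) (l k) \<le> Ms * real K powr (- a)"
      "feas_residual R (w (Suc k)) \<le> Mf * real K powr (- r)"
      "comp_residual R (w (Suc k)) (l k) \<le> Mc * real K powr (- r)"
    using rate[OF K(1)] unfolding a_def by blast
  have "Ms powr (1 / a) * es powr (- 1 / a) \<le> B * H" "Mf powr (1 / r) * ef powr (- 1 / r) \<le> B * H"
    "Mc powr (1 / r) * ec powr (- 1 / r) \<le> B * H"
    using B H by (auto intro!: mult_mono)
  then have "Ms * real K powr (- a) \<le> es" "Mf * real K powr (- r) \<le> ef" "Mc * real K powr (- r) \<le> ec"
    using KB(1) K(2) Ms tol a(1) mu_rate(1) by (auto intro!: powr_rate_le)
  then have "KKT_point C f R es ef ec (w (Suc k))"
    using k wC unfolding KKT_point_def by fastforce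
  moreover have "real (Suc k) \<le> (B + 2) * H"
    using k(1) KB(2) H(1) by (simp add: algebra_simps)
  ultimately show ?thesis unfolding H_def a(3) by blast
qed

end

theorem theorem6:
  fixes X :: "'a::euclidean_space set" and Y :: "'b::euclidean_space set"
    and C :: "('a \<times> 'b) set"
    and f g R :: "'a \<times> 'b \<Rightarrow> real"
    and \<sigma> \<rho> \<delta> L_f L_g L_xy L_R B_R :: real
    and \<phi> :: "real \<Rightarrow> real \<Rightarrow> real" and a1 a2 b_phi c_phi :: real
    and c1 c2 theta_low theta_hat :: real
    and w0 :: "'a \<times> 'b"
    and \<mu> \<zeta> grid :: "nat \<Rightarrow> real"
    and rule :: step_rule
    and M_gamma r q zeta_bar :: real
  assumes X: "X \<noteq> {}" "compact X" "convex X"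
    and Y: "Y \<noteq> {}" "compact Y" "convex Y"
    and C: "C = X \<times> Y"
    and f: "C1_near C f" "L_f-lipschitz_on C (grad f)"
    and g: "C1_near C g" "L_g-lipschitz_on C (grad g)"
    and weak_convexity: "\<sigma> \<ge> 0" "\<forall>x\<in>X. convex_on Y (\<lambda>y. g (x, y) + \<sigma> / 2 * (norm y)\<^sup>2)"
    and reg: "\<rho> > 0" "\<rho> * \<sigma> < 1" "\<delta> > 0"
    and R: "R = residual Y g \<rho> \<delta>"
    and L_xy: "L_xy > 0" "\<forall>x\<in>X. L_xy-lipschitz_on Y (\<lambda>y. fst (grad g (x, y)))"
    and L_R: "L_R > 0" "L_R-lipschitz_on C (grad R)"
    and B_R: "B_R > 0" "\<forall>w\<in>C. norm (grad R w) \<le> B_R"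
    and smoothing: "smoothing \<phi> a1 a2 b_phi c_phi" "a1 + a2 > 0"
    and params: "c1 > 0" "c2 > 0" "theta_low > 0" "0 < theta_hat" "theta_hat < 2" "w0 \<in> C"
    and mu: "\<forall>k. \<mu> k > 0" "decseq \<mu>" "\<mu> \<longlonglongrightarrow> 0"
    and zeta: "\<forall>k. \<zeta> k > 0" "decseq \<zeta>" "\<zeta> \<longlonglongrightarrow> 0"
    and grid: "\<forall>t. grid t > 0" "\<forall>t. grid (Suc t) < grid t" "grid \<longlonglongrightarrow> 0"
    and ennamcq: "ENNAMCQ C R"
    and grid_ratio: "M_gamma > 1" "\<forall>t. grid t \<le> M_gamma * grid (Suc t)"
    and mu_rate: "0 < r" "r < 1" "\<mu> \<in> \<Theta>(\<lambda>k. (1 + real k) powr (- r))"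
    and zeta_rate: "zeta_bar > 0" "q > 1 / r" "\<forall>k. \<zeta> k \<le> zeta_bar * \<mu> k powr q"
  shows "\<exists>M_s M_f M_c M_it :: real. \<exists>K0 :: nat. \<forall>w z t.
    ivsp_algorithm.run X Y f g \<sigma> \<rho> \<delta> L_f L_xy L_R B_R \<phi> a1 a2 b_phi c1 c2
      theta_low theta_hat w0 \<mu> \<zeta> grid rule w z t \<longrightarrow>
    (\<forall>K\<ge>K0. \<exists>k. \<lceil>real K / 2\<rceil> \<le> int k \<and> k \<le> K \<and>
       (let l = ivsp_algorithm.multiplier g \<rho> \<delta> \<phi> \<mu> grid w z t k in
          stat_residual C f R (w (Suc k)) l \<le> M_s * real K powr (- ((1 - r) / 2)) \<and>
          feas_residual R (w (Suc k)) \<le> M_f * real K powr (- r) \<and>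
          comp_residual R (w (Suc k)) l \<le> M_c * real K powr (- r))) \<and>
    (\<forall>es ef ec. 0 < es \<and> es \<le> 1 \<and> 0 < ef \<and> ef \<le> 1 \<and> 0 < ec \<and> ec \<le> 1 \<longrightarrow>
       (\<exists>j. real j \<le> M_it * max (es powr (- 2 / (1 - r)))
                              (max (ef powr (- 1 / r)) (ec powr (- 1 / r))) \<and>
            KKT_point C f R es ef ec (w j)))"
proof -
  interpret ivsp_setting X Y f g \<sigma> \<rho> \<delta> L_f L_xy L_R B_R \<phi> a1 a2 b_phi c1 c2 theta_low theta_hat
    w0 \<mu> \<zeta> grid rule c_phi r q zeta_bar
  proof (rule ivsp_setting.intro)
    show "decseq grid" using grid(2) by (simp add: decseq_Suc_iff less_imp_le)
  qed (use assms in \<open>simp_all\<close>)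
  obtain Ms Mf Mc K0 where M: "0 \<le> Ms" "0 \<le> Mf" "0 \<le> Mc" and
    rate: "\<And>w z t K. run w z t \<Longrightarrow> K \<ge> K0 \<Longrightarrow> 1 \<le> K \<and> (\<exists>k. K \<le> 2 * k \<and> k \<le> K \<and> 0 \<le> multiplier w z t k \<and>
      stat_residual (X \<times> Y) f (residual Y g \<rho> \<delta>) (w (Suc k)) (multiplier w z t k) \<le> Ms * real K powr (- ((1 - r) / 2)) \<and>
      feas_residual (residual Y g \<rho> \<delta>) (w (Suc k)) \<le> Mf * real K powr (- r) \<and>
      comp_residual (residual Y g \<rho> \<delta>) (w (Suc k)) (multiplier w z t k) \<le> Mc * real K powr (- r))"
    using ivsp_setting.rate[OF ivsp_setting_axioms] by blast
  define B where "B = real (max K0 1) + Ms powr (2 / (1 - r)) + Mf powr (1 / r) + Mc powr (1 / r)"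
  show ?thesis
  proof (rule exI[of _ Ms], rule exI[of _ Mf], rule exI[of _ Mc], rule exI[of _ "B + 2"],
      rule exI[of _ K0], intro allI impI conjI)
    fix w z t K assume run: "run w z t" and K: "K0 \<le> K"
    obtain k where k: "K \<le> 2 * k" "k \<le> K"
      "stat_residual C f R (w (Suc k)) (multiplier w z t k) \<le> Ms * real K powr (- ((1 - r) / 2))"
      "feas_residual R (w (Suc k)) \<le> Mf * real K powr (- r)"
      "comp_residual R (w (Suc k)) (multiplier w z t k) \<le> Mc * real K powr (- r)"
      using rate[OF run K] unfolding C R by blast
    have "\<lceil>real K / 2\<rceil> \<le> int k" using k(1) by (simp add: ceiling_le_iff)
    then show "\<exists>k. \<lceil>real K / 2\<rceil> \<le> int k \<and> k \<le> K \<and>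
       (let l = multiplier w z t k in
          stat_residual C f R (w (Suc k)) l \<le> Ms * real K powr (- ((1 - r) / 2)) \<and>
          feas_residual R (w (Suc k)) \<le> Mf * real K powr (- r) \<and>
          comp_residual R (w (Suc k)) l \<le> Mc * real K powr (- r))"
      using k unfolding Let_def by blast
  next
    fix w z t and es ef ec :: real
    assume run: "run w z t" and tol: "0 < es \<and> es \<le> 1 \<and> 0 < ef \<and> ef \<le> 1 \<and> 0 < ec \<and> ec \<le> 1"
    have "\<exists>j. real j \<le> (B + 2) * max (es powr (- 2 / (1 - r))) (max (ef powr (- 1 / r)) (ec powr (- 1 / r)))
      \<and> KKT_point (X \<times> Y) f (residual Y g \<rho> \<delta>) es ef ec (w j)"
      unfolding B_def
    proof (rule complexity[where l = "multiplier w z t"])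
      fix K assume "max K0 1 \<le> K"
      then show "\<exists>k\<le>K. 0 \<le> multiplier w z t k \<and>
        stat_residual (X \<times> Y) f (residual Y g \<rho> \<delta>) (w (Suc k)) (multiplier w z t k) \<le> Ms * real K powr (- ((1 - r) / 2)) \<and>
        feas_residual (residual Y g \<rho> \<delta>) (w (Suc k)) \<le> Mf * real K powr (- r) \<and>
        comp_residual (residual Y g \<rho> \<delta>) (w (Suc k)) (multiplier w z t k) \<le> Mc * real K powr (- r)"
        using rate[OF run, of K] by auto
    qed (use M tol run_iterates[OF run] in auto)
    then show "\<exists>j. real j \<le> (B + 2) * max (es powr (- 2 / (1 - r))) (max (ef powr (- 1 / r)) (ec powr (- 1 / r)))
      \<and> KKT_point C f R es ef ec (w j)" unfolding C R .
  qed
qed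

end
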